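(* Let $\operatorname{div}:Y\to X$ be the discretized divergence operator, $A=[I,-I]:X\times X\to X$, $B=\operatorname{div}$, let $I$ denote the identity operator and $I_2=\mathrm{Diag}[I,I]$ the identity on $X\times X$. Then $$8I\ \ge\ \operatorname{div}^*\operatorname{div},\qquad 2I_2\ \ge\ A^*A .$$ Consequently, for any $c>0$, the choice $N=8cI$ (on $Y$) and $M=2cI_2$ (on $X\times X$) satisfies $$N-cB^*B\ge 0,\qquad M-cA^*A\ge 0 .$$ Moreover, with this choice of $N$ and $M$, if $\{\rho_k\}$ is a non-decreasing sequence with $\rho_k\in(0,2)$ for all $k$, then for any starting point $(q^0,p^0,u^0)\in Y\times (X\times X)\times X$ the sequence $(q^k,p^k,u^k)$ generated by $$\begin{aligned} q^{k+1}&=(N+\partial H)^{-1}\big(B^*(-cAp^k+u^k)+(N-cB^*B)q^k\big),\\ p^{k+1}&=(M+\partial G)^{-1}\big(A^*(-c\rho_kBq^{k+1}+c(1-\rho_k)Ap^k+u^k)+(M-cA^*A)p^k\big),\\ u^{k+1}&=u^k-c\big(Ap^{k+1}-(1-\rho_k)Ap^k+\rho_kBq^{k+1}\big) \end{aligned}$$ converges weakly to a saddle-point $(q^*,p^*,u^* )$ of the augmented Lagrangian $$L(u,p,q)=-G(p)-H(q)+\langle u,Ap+Bq\rangle-\tfrac c2\|Ap+Bq\|_2^2$$ (minimized over $u$, maximized over $(p,q)$), and $(q^*,p^* )$ is a solution of $$\max_{p,q}\ -G(p)-H(q)\quad\text{subject to}\quad Ap+Bq=0 .$$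
   Context: Discrete setting: $\Omega$ is a finite rectangular two-dimensional pixel grid with mesh size $1$; $X=\mathbb{R}^{\Omega}$ and $Y=(\mathbb{R}^2)^{\Omega}$ carry the standard Euclidean inner products. $\nabla:X\to Y$ is the standard forward-difference gradient (with difference set to $0$ at the last row/column in the respective direction, i.e. Neumann boundary conditions), and $\operatorname{div}:=-\nabla^*:Y\to X$, so $\operatorname{div}^*=-\nabla$. For self-adjoint operators, $S\ge T$ means that $S-T$ is positive semi-definite. Data: $\alpha>0$ and real-valued functions $C_s,C_t\in X$. The variable $p$ is the pair $p=(p_s,p_t)\in X\times X$. $I_{D}$ with a set subscript denotes the indicator function of the set $D$ ($0$ on $D$, $+\infty$ outside). The functions are $$G(p)=-\langle 1,p_s\rangle+I_{\{p_s\le C_s\}}(p_s)+I_{\{p_t\le C_t\}}(p_t),\qquad H(q)=I_{\{\|q\|_\infty\le\alpha\}}(q),$$ where the inequalities $p_s\le C_s$, $p_t\le C_t$ are pointwise, $1$ is the constant function, and $\|q\|_\infty=\max_{x\in\Omega}|q(x)|$ with $|\cdot|$ the Euclidean norm on $\mathbb{R}^2$. $\partial$ denotes the convex subdifferential. A saddle-point of $L$ is a triple $(q^*,p^*,u^* )$ with $L(u^*,p,q)\le L(u^*,p^*,q^* )\le L(u,p^*,q^* )$ for all $u,p,q$. *)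

theory Defs
  imports "HOL-Analysis.Analysis"
begin

text \<open>
  The pixel grid is \<open>'m \<times> 'n\<close> for finite linearly ordered index types, i.e. a
  \<open>CARD('m) \<times> CARD('n)\<close> rectangle; the order tells which pixel comes next in each direction.
\<close>

type_synonym ('m, 'n) img = "real ^ ('m \<times> 'n)"
type_synonym ('m, 'n) vfield = "(real ^ 2) ^ ('m \<times> 'n)"

definition forward_diff :: "('a :: {finite, linorder} \<Rightarrow> real) \<Rightarrow> 'a \<Rightarrow> real" where
  "forward_diff f i = (if \<exists>j. i < j then f (Min {j. i < j}) - f i else 0)"

definition grad ::
  "('m :: {finite, linorder}, 'n :: {finite, linorder}) img \<Rightarrow> ('m, 'n) vfield" where
  "grad u = (\<chi> x. vector [forward_diff (\<lambda>i. u $ (i, snd x)) (fst x),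
                          forward_diff (\<lambda>j. u $ (fst x, j)) (snd x)])"

definition dvg ::
  "('m :: {finite, linorder}, 'n :: {finite, linorder}) vfield \<Rightarrow> ('m, 'n) img" where
  "dvg q = - adjoint grad q"

definition selfadjoint :: "('a :: real_inner \<Rightarrow> 'a) \<Rightarrow> bool" where
  "selfadjoint S \<longleftrightarrow> linear S \<and> (\<forall>x y. S x \<bullet> y = x \<bullet> S y)"

definition op_ge :: "('a :: real_inner \<Rightarrow> 'a) \<Rightarrow> ('a \<Rightarrow> 'a) \<Rightarrow> bool" where
  "op_ge S T \<longleftrightarrow> selfadjoint S \<and> selfadjoint T \<and> (\<forall>x. 0 \<le> x \<bullet> (S x - T x))"

definition ind_fun :: "'a set \<Rightarrow> 'a \<Rightarrow> ereal" where
  "ind_fun D x = (if x \<in> D then 0 else \<infinity>)"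

definition subdiff :: "('a :: real_inner \<Rightarrow> ereal) \<Rightarrow> 'a \<Rightarrow> 'a set" where
  "subdiff F x = {v. \<bar>F x\<bar> \<noteq> \<infinity> \<and> (\<forall>y. F x + ereal (v \<bullet> (y - x)) \<le> F y)}"

text \<open>The resolvent \<open>(N + \<partial>F)\<^sup>-\<^sup>1\<close>, read as a single-valued map: the unique \<open>x\<close> with
  \<open>z \<in> N x + \<partial>F(x)\<close>; meaningful where such an \<open>x\<close> exists uniquely, e.g. for positive
  definite \<open>N\<close> and proper closed convex \<open>F\<close>.\<close>

definition resolvent ::
  "('a :: real_inner \<Rightarrow> 'a) \<Rightarrow> ('a \<Rightarrow> ereal) \<Rightarrow> 'a \<Rightarrow> 'a" where
  "resolvent N F z = (THE x. \<exists>v \<in> subdiff F x. z = N x + v)"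

definition generates_iterates ::
  "('p :: euclidean_space \<Rightarrow> 'x :: euclidean_space) \<Rightarrow> ('q :: euclidean_space \<Rightarrow> 'x) \<Rightarrow>
   ('p \<Rightarrow> ereal) \<Rightarrow> ('q \<Rightarrow> ereal) \<Rightarrow> real \<Rightarrow> ('q \<Rightarrow> 'q) \<Rightarrow> ('p \<Rightarrow> 'p) \<Rightarrow> (nat \<Rightarrow> real) \<Rightarrow>
   (nat \<Rightarrow> 'q) \<Rightarrow> (nat \<Rightarrow> 'p) \<Rightarrow> (nat \<Rightarrow> 'x) \<Rightarrow> bool" where
  "generates_iterates A B G H c N M \<rho> q p u \<longleftrightarrow>
     (\<forall>k. q (Suc k) = resolvent N H
            (adjoint B (- c *\<^sub>R A (p k) + u k) + (N (q k) - c *\<^sub>R adjoint B (B (q k)))) \<and>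
          p (Suc k) = resolvent M G
            (adjoint A (- (c * \<rho> k) *\<^sub>R B (q (Suc k)) + (c * (1 - \<rho> k)) *\<^sub>R A (p k) + u k)
             + (M (p k) - c *\<^sub>R adjoint A (A (p k)))) \<and>
          u (Suc k) = u k - c *\<^sub>R
            (A (p (Suc k)) - (1 - \<rho> k) *\<^sub>R A (p k) + \<rho> k *\<^sub>R B (q (Suc k))))"

definition aug_lagrangian ::
  "('p \<Rightarrow> 'x :: real_inner) \<Rightarrow> ('q \<Rightarrow> 'x) \<Rightarrow> ('p \<Rightarrow> ereal) \<Rightarrow> ('q \<Rightarrow> ereal) \<Rightarrow> real \<Rightarrow>
   'x \<Rightarrow> 'p \<Rightarrow> 'q \<Rightarrow> ereal" where
  "aug_lagrangian A B G H c u p q =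
     - G p - H q + ereal (u \<bullet> (A p + B q)) - ereal (c / 2 * (norm (A p + B q))\<^sup>2)"

definition saddle_point ::
  "('x \<Rightarrow> 'p \<Rightarrow> 'q \<Rightarrow> ereal) \<Rightarrow> 'q \<times> 'p \<times> 'x \<Rightarrow> bool" where
  "saddle_point L = (\<lambda>(qs, ps, us).
     \<forall>u p q. L us p q \<le> L us ps qs \<and> L us ps qs \<le> L u ps qs)"

definition solves_constrained_max ::
  "('p \<Rightarrow> 'x :: real_vector) \<Rightarrow> ('q \<Rightarrow> 'x) \<Rightarrow> ('p \<Rightarrow> ereal) \<Rightarrow> ('q \<Rightarrow> ereal) \<Rightarrow>
   'q \<times> 'p \<Rightarrow> bool" where
  "solves_constrained_max A B G H = (\<lambda>(qs, ps).
     A ps + B qs = 0 \<and>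
     (\<forall>p q. A p + B q = 0 \<longrightarrow> - G p - H q \<le> - G ps - H qs))"

definition weakly_converges :: "(nat \<Rightarrow> 'a :: real_normed_vector) \<Rightarrow> 'a \<Rightarrow> bool" where
  "weakly_converges z l \<longleftrightarrow>
     (\<forall>\<phi> :: 'a \<Rightarrow> real. bounded_linear \<phi> \<longrightarrow> (\<lambda>k. \<phi> (z k)) \<longlonglongrightarrow> \<phi> l)"

definition A_op :: "('m :: finite, 'n :: finite) img \<times> ('m, 'n) img \<Rightarrow> ('m, 'n) img" where
  "A_op p = fst p - snd p"

definition sup_norm :: "('m :: finite, 'n :: finite) vfield \<Rightarrow> real" where
  "sup_norm q = (MAX x. norm (q $ x))"

definition G_fun ::
  "('m :: finite, 'n :: finite) img \<Rightarrow> ('m, 'n) img \<Rightarrow>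
   ('m, 'n) img \<times> ('m, 'n) img \<Rightarrow> ereal" where
  "G_fun C\<^sub>s C\<^sub>t p = ereal (- (1 \<bullet> fst p))
     + ind_fun {p\<^sub>s. \<forall>x. p\<^sub>s $ x \<le> C\<^sub>s $ x} (fst p)
     + ind_fun {p\<^sub>t. \<forall>x. p\<^sub>t $ x \<le> C\<^sub>t $ x} (snd p)"

definition H_fun :: "real \<Rightarrow> ('m :: finite, 'n :: finite) vfield \<Rightarrow> ereal" where
  "H_fun \<alpha> = ind_fun {q. sup_norm q \<le> \<alpha>}"

end

(*
  Put z_k = u_k + c A p_k and r_k = A p_k + B q_{k+1}, and let N - c B*B and M - c A*A act as
  positive semidefinite forms. Relative to any KKT point,
    |z_k - z*|^2 / (c rho_k) + |q_k - q*|^2_{N - cB*B} + |p_{k-1} - p*|^2_{M - cA*A}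
  drops in each step by the squared seminorms of the increments of q and p plus
  (2 - rho_k) c |r_k|^2; monotonicity of rho makes the weight 1/(c rho_k) harmless. Once r_k -> 0,
  every cluster point is a KKT point, and the Lyapunov function at that point forces convergence of
  the whole sequence.

  If lim rho_k < 2, then r_k -> 0 at once. If rho_k -> 2 (which the hypotheses allow) the term in
  r_k gives nothing, and the structure of the problem is needed. Along a window of consecutive
  limit states q is constant, because |div q|^2 < 8 |q|^2 for q nonzero, and p_s + p_t is constant.
  At each pixel the KKT conditions for p then leave p_s - p_t at most two values, one with u = -1
  and one with u = 0, or else a single value; the reflection u' + c r' = u - c r excludes a jump
  between the two values in the interior of the window. So r is constant over two steps, while
  z moves by -2 c r and keeps its distance to z*, whence r = 0.
*)
theory Submission
  imports Defs
begin

section \<open>Sequences, resolvents and semidefinite forms\<close>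

text \<open>Needed where the residual is visible only through cluster points: if convergence failed,
  some subsequence would stay at distance at least \<open>e\<close> from \<open>L\<close>, and so
  would each of its refinements.\<close>

lemma tendsto_subseq_criterion:
  fixes X :: "nat \<Rightarrow> 'a::metric_space"
  assumes "\<And>f. strict_mono f \<Longrightarrow> \<exists>g. strict_mono (g::nat\<Rightarrow>nat) \<and> (\<lambda>k. X (f (g k))) \<longlonglongrightarrow> L"
  shows "X \<longlonglongrightarrow> L"
proof (rule ccontr)
  assume "\<not> X \<longlonglongrightarrow> L"
  then obtain e where e: "e > 0" "\<forall>N. \<exists>n\<ge>N. \<not> dist (X n) L < e"
    unfolding lim_sequentially by blast
  then have inf: "infinite {n. \<not> dist (X n) L < e}"
    by (metis (no_types, lifting) infinite_nat_iff_unbounded_le mem_Collect_eq)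
  obtain f :: "nat \<Rightarrow> nat" where f: "strict_mono f" "\<And>k. f k \<in> {n. \<not> dist (X n) L < e}"
    using infinite_enumerate[OF inf] by blast
  obtain g :: "nat \<Rightarrow> nat" where g: "(\<lambda>k. X (f (g k))) \<longlonglongrightarrow> L"
    using assms[OF f(1)] by blast
  then obtain k where "dist (X (f (g k))) L < e"
    using e(1) unfolding lim_sequentially by blast
  with f(2)[of "g k"] show False by simp
qed

text \<open>One refinement per shift \<open>i\<close> makes \<open>N\<close> consecutive terms
  converge along a common subsequence, so that limits of successive iterates can be compared through
  the recursion.\<close>

lemma convergent_window:
  fixes Y :: "nat \<Rightarrow> 'a::heine_borel"
  assumes "bounded (range Y)"
  shows "\<exists>g L. strict_mono (g::nat\<Rightarrow>nat) \<and> (\<forall>i<(N::nat). (\<lambda>k. Y (f (g k) + i)) \<longlonglongrightarrow> L i)"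
proof (induction N)
  case 0
  show ?case by (rule exI[of _ id]) (simp add: strict_mono_def)
next
  case (Suc N)
  then obtain g L where g: "strict_mono (g::nat\<Rightarrow>nat)"
    and L: "\<And>i. i<N \<Longrightarrow> (\<lambda>k. Y (f (g k) + i)) \<longlonglongrightarrow> L i" by blast
  have "bounded (range (\<lambda>k. Y (f (g k) + N)))"
    by (rule bounded_subset[OF assms]) auto
  then obtain l h where h: "strict_mono (h::nat\<Rightarrow>nat)" "((\<lambda>k. Y (f (g k) + N)) \<circ> h) \<longlonglongrightarrow> l"
    using bounded_imp_convergent_subsequence by blast
  have "(\<lambda>k. Y (f ((g \<circ> h) k) + i)) \<longlonglongrightarrow> (L(N := l)) i" if "i < Suc N" for i
  proof (cases "i = N")
    case True
    then show ?thesis using h(2) by (simp add: o_def)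
  next
    case False
    then show ?thesis
      using that LIMSEQ_subseq_LIMSEQ[OF L[of i] h(1)] by (simp add: o_def)
  qed
  moreover have "strict_mono (g \<circ> h)" using g h(1) by (rule strict_mono_o)
  ultimately show ?case by blast
qed

lemma decseq_nonneg_diff_tendsto_0:
  fixes V D :: "nat \<Rightarrow> real"
  assumes "\<And>k. 0 \<le> V k" "\<And>k. 0 \<le> D k" "\<And>k. V (Suc k) + D k \<le> V k"
  shows "convergent V" "D \<longlonglongrightarrow> 0"
proof -
  have dec: "decseq V"
    by (rule decseq_SucI) (use assms in \<open>smt (verit)\<close>)
  then show c: "convergent V"
    using decseq_convergent[of V 0] assms(1) by (metis convergentI)
  then obtain l where l: "V \<longlonglongrightarrow> l" by (auto simp: convergent_def)
  have "(\<lambda>k. V k - V (Suc k)) \<longlonglongrightarrow> l - l"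
    by (intro tendsto_diff l LIMSEQ_Suc)
  then have *: "(\<lambda>k. V k - V (Suc k)) \<longlonglongrightarrow> 0" by simp
  show "D \<longlonglongrightarrow> 0"
    by (rule tendsto_sandwich[OF _ _ tendsto_const *])
       (use assms in \<open>auto intro!: always_eventually simp: algebra_simps\<close>)
qed

lemma power2_norm_tendsto_0_imp:
  assumes "(\<lambda>k. (norm (X k))\<^sup>2) \<longlonglongrightarrow> 0"
  shows "X \<longlonglongrightarrow> 0"
  using tendsto_real_sqrt[OF assms] by (simp add: tendsto_norm_zero_iff)

lemma tendsto_of_power2_norm_le:
  fixes X :: "nat \<Rightarrow> 'a::real_normed_vector"
  assumes "\<And>k. d * (norm (X (Suc k) - a))\<^sup>2 \<le> b k" "b \<longlonglongrightarrow> 0" "(d::real) > 0"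
  shows "X \<longlonglongrightarrow> a"
proof -
  have "(\<lambda>k. b k / d) \<longlonglongrightarrow> 0 / d" by (intro tendsto_intros assms) (use assms in simp)
  then have *: "(\<lambda>k. b k / d) \<longlonglongrightarrow> 0" by simp
  have "(\<lambda>k. (norm (X (Suc k) - a))\<^sup>2) \<longlonglongrightarrow> 0"
    by (rule tendsto_sandwich[OF _ _ tendsto_const *])
       (use assms in \<open>auto simp: field_simps\<close>)
  then have "(\<lambda>k. X (Suc k) - a) \<longlonglongrightarrow> 0" by (rule power2_norm_tendsto_0_imp)
  then have "(\<lambda>k. X (Suc k)) \<longlonglongrightarrow> a" by (rule LIM_zero_cancel)
  then show ?thesis by (rule LIMSEQ_imp_Suc)
qed

section \<open>Variational inequalities for resolvents of linear functions plus indicators\<close>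

lemma subdiff_linear_plus_ind:
  fixes l :: "'a::euclidean_space"
  shows "v \<in> subdiff (\<lambda>x. ereal (- (l \<bullet> x)) + ind_fun C x) x
    \<longleftrightarrow> x \<in> C \<and> (\<forall>y\<in>C. (v + l) \<bullet> (y - x) \<le> 0)"
  by (auto simp: subdiff_def ind_fun_def inner_add_left inner_diff_right algebra_simps)

text \<open>When \<open>N\<close> is a multiple of the identity, the inclusion says that
  \<open>x\<close> is the projection of \<open>(z + l) / a\<close> onto \<open>C\<close>. Existence
  and uniqueness of the projection give the definite description in \<open>resolvent\<close> its
  meaning.\<close>

lemma resolvent_linear_plus_ind:
  fixes l z :: "'a::euclidean_space"
  assumes "closed C" "convex C" "C \<noteq> {}" "a > 0"
  defines "x \<equiv> resolvent (\<lambda>x. a *\<^sub>R x) (\<lambda>x. ereal (- (l \<bullet> x)) + ind_fun C x) z"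
  shows "x \<in> C" "y \<in> C \<Longrightarrow> (z - a *\<^sub>R x + l) \<bullet> (y - x) \<le> 0"
proof -
  let ?F = "\<lambda>x. ereal (- (l \<bullet> x)) + ind_fun C x"
  let ?P = "\<lambda>x. \<exists>v \<in> subdiff ?F x. z = a *\<^sub>R x + v"
  have iff: "?P x \<longleftrightarrow> x \<in> C \<and> (\<forall>y\<in>C. (z - a *\<^sub>R x + l) \<bullet> (y - x) \<le> 0)" for x
  proof -
    have "z = a *\<^sub>R x + v \<longleftrightarrow> v = z - a *\<^sub>R x" for v
      by (auto simp: algebra_simps)
    then have "?P x \<longleftrightarrow> z - a *\<^sub>R x \<in> subdiff ?F x" by simp
    then show ?thesis by (simp add: subdiff_linear_plus_ind)
  qed
  define w where "w = (1/a) *\<^sub>R (z + l)"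
  have w: "z - a *\<^sub>R x + l = a *\<^sub>R (w - x)" for x
    using assms(4) by (simp add: w_def algebra_simps)
  have ex: "?P (closest_point C w)"
    unfolding iff w
    using closest_point_in_set[OF assms(1,3)] closest_point_dot[OF assms(2,1)] assms(4)
    by (auto simp: mult_nonneg_nonpos)
  \<comment> \<open>Each solution is a test point for the other; the two inequalities add up to
    \<open>a\<close> times the squared distance being nonpositive.\<close>
  have un: "x = y" if "?P x" "?P y" for x y
  proof -
    from that have "(z - a *\<^sub>R x + l) \<bullet> (y - x) \<le> 0" "(z - a *\<^sub>R y + l) \<bullet> (x - y) \<le> 0"
      unfolding iff by auto
    then have "a * ((y - x) \<bullet> (y - x)) \<le> 0"
      by (simp add: inner_add_left inner_diff_left inner_diff_right inner_commute algebra_simps)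
    then have "(y - x) \<bullet> (y - x) \<le> 0" using assms(4) by (simp add: mult_le_0_iff)
    then show ?thesis
      by (metis eq_iff_diff_eq_0 inner_eq_zero_iff inner_ge_zero order_antisym)
  qed
  have "?P x" unfolding x_def resolvent_def by (rule theI[of ?P, OF ex]) (use un ex in blast)
  then show "x \<in> C" "y \<in> C \<Longrightarrow> (z - a *\<^sub>R x + l) \<bullet> (y - x) \<le> 0"
    unfolding iff by auto
qed

text \<open>The forms met later are only semidefinite, so a null vector \<open>y\<close> needs a
  case of its own.\<close>

lemma psd_form_cauchy_schwarz:
  fixes T :: "'a::real_inner \<Rightarrow> 'a \<Rightarrow> real"
  assumes "bilinear T" "\<And>x y. T x y = T y x" "\<And>x. 0 \<le> T x x"
  shows "(T x y)\<^sup>2 \<le> T x x * T y y"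
proof -
  have exp: "T (x - t *\<^sub>R y) (x - t *\<^sub>R y) = T x x - 2 * t * T x y + t\<^sup>2 * T y y" for t
    using assms(1,2) by (simp add: bilinear_lsub bilinear_rsub bilinear_lmul bilinear_rmul
        power2_eq_square algebra_simps)
  show ?thesis
  proof (cases "T y y = 0")
    case True
    have "T x y = 0"
    proof (rule ccontr)
      assume "T x y \<noteq> 0"
      \<comment> \<open>For null \<open>y\<close> the form at \<open>x - t *\<^sub>R y\<close> is
        affine in \<open>t\<close>; this \<open>t\<close> makes it \<open>-1\<close>.\<close>
      then show False
        using exp[of "(T x x + 1) / (2 * T x y)"] assms(3)[of "x - ((T x x + 1) / (2 * T x y)) *\<^sub>R y"] True
        by simp
    qed
    then show ?thesis using True by simp
  next
    case False
    then have pos: "T y y > 0" using assms(3)[of y] by simp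
    \<comment> \<open>\<open>t = T x y / T y y\<close> minimizes the quadratic \<open>exp\<close> in
      \<open>t\<close>.\<close>
    have "0 \<le> T x x - 2 * (T x y / T y y) * T x y + (T x y / T y y)\<^sup>2 * T y y"
      using exp[of "T x y / T y y"] assms(3)[of "x - (T x y / T y y) *\<^sub>R y"] by simp
    also have "\<dots> = T x x - (T x y)\<^sup>2 / T y y"
      using pos by (simp add: power2_eq_square)
    finally show ?thesis using pos by (simp add: field_simps)
  qed
qed

section \<open>KKT points of the constrained problem\<close>

locale constrained_problem =
  fixes A :: "'p::euclidean_space \<Rightarrow> 'x::euclidean_space"
    and B :: "'q::euclidean_space \<Rightarrow> 'x"
    and l :: 'p and P :: "'p set" and Q :: "'q set"
  assumes lin_A: "linear A" and lin_B: "linear B"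
begin

text \<open>The inequalities place \<open>l + adjoint A u\<close> in the normal cone of
  \<open>P\<close> at \<open>p\<close> and \<open>adjoint B u\<close> in that of \<open>Q\<close> at
  \<open>q\<close>: stationarity for maximizing \<open>l \<bullet> p\<close> under the
  constraint.\<close>

definition kkt :: "'q \<Rightarrow> 'p \<Rightarrow> 'x \<Rightarrow> bool" where
  "kkt q p u \<longleftrightarrow> q \<in> Q \<and> p \<in> P \<and> A p + B q = 0 \<and>
     (\<forall>x\<in>P. l \<bullet> (x - p) + u \<bullet> A (x - p) \<le> 0) \<and> (\<forall>x\<in>Q. u \<bullet> B (x - q) \<le> 0)"

text \<open>Both stationarity inequalities are added and feasibility is used. The saddle-point
  property and optimality both come from this estimate.\<close>

lemma kkt_lagrangian_le:
  assumes "kkt q p u" "x \<in> P" "y \<in> Q"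
  shows "l \<bullet> x + u \<bullet> (A x + B y) \<le> l \<bullet> p"
proof -
  have "l \<bullet> (x - p) + u \<bullet> A (x - p) \<le> 0" "u \<bullet> B (y - q) \<le> 0" "u \<bullet> (A p + B q) = 0"
    using assms by (auto simp: kkt_def)
  then show ?thesis
    by (simp add: linear_diff[OF lin_A] linear_diff[OF lin_B] inner_diff_right inner_add_right)
qed

lemma kkt_saddle_point:
  assumes "kkt q p u" "0 \<le> c"
  shows "saddle_point (aug_lagrangian A B (\<lambda>x. ereal (- (l \<bullet> x)) + ind_fun P x) (ind_fun Q) c) (q, p, u)"
proof -
  have pq: "p \<in> P" "q \<in> Q" "A p + B q = 0" using assms by (auto simp: kkt_def)
  show ?thesis
    unfolding saddle_point_def prod.case
  proof (intro allI conjI)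
    fix v x y
    let ?L = "aug_lagrangian A B (\<lambda>x. ereal (- (l \<bullet> x)) + ind_fun P x) (ind_fun Q) c"
    \<comment> \<open>At a feasible pair the multiplier drops out and the penalty vanishes.\<close>
    show "?L u p q \<le> ?L v p q" using pq by (simp add: aug_lagrangian_def ind_fun_def)
    show "?L u x y \<le> ?L u p q"
    proof (cases "x \<in> P \<and> y \<in> Q")
      case True
      \<comment> \<open>Away from feasibility the penalty only lowers the value.\<close>
      moreover have "0 \<le> c * (norm (A x + B y))\<^sup>2 / 2" using assms(2) by simp
      ultimately show ?thesis
        using pq kkt_lagrangian_le[OF assms(1), of x y]
        by (simp add: aug_lagrangian_def ind_fun_def)
    qed (auto simp: aug_lagrangian_def ind_fun_def)
  qed
qed

lemma kkt_solves:
  assumes "kkt q p u"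
  shows "solves_constrained_max A B (\<lambda>x. ereal (- (l \<bullet> x)) + ind_fun P x) (ind_fun Q) (q, p)"
  unfolding solves_constrained_max_def prod.case
proof (intro allI conjI impI)
  have pq: "p \<in> P" "q \<in> Q" using assms by (auto simp: kkt_def)
  show "A p + B q = 0" using assms by (auto simp: kkt_def)
  fix x y assume "A x + B y = 0"
  then show "- (ereal (- (l \<bullet> x)) + ind_fun P x) - ind_fun Q y
      \<le> - (ereal (- (l \<bullet> p)) + ind_fun P p) - ind_fun Q q"
    using pq kkt_lagrangian_le[OF assms, of x y]
    by (cases "x \<in> P"; cases "y \<in> Q") (auto simp: ind_fun_def)
qed

lemma kkt_exists:
  assumes "convex P" "convex Q"
    and opt: "p \<in> P" "q \<in> Q" "A p + B q = 0"
      "\<And>x y. x \<in> P \<Longrightarrow> y \<in> Q \<Longrightarrow> A x + B y = 0 \<Longrightarrow> l \<bullet> x \<le> l \<bullet> p"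
    and slater: "e > 0" "ball 0 e \<subseteq> {A x + B y |x y. x \<in> P \<and> y \<in> Q}"
  shows "\<exists>u. kkt q p u"
proof -
  \<comment> \<open>Separate the optimal point from the strict hypograph of the perturbed problem;
    the Slater condition makes the separating hyperplane non-vertical.\<close>
  define W where "W = {(A x + B y, t) |x y t. x \<in> P \<and> y \<in> Q \<and> t < l \<bullet> x}"
  have "convex W"
    unfolding convex_alt
  proof (intro ballI allI impI)
    fix w w' s assume "w \<in> W" "w' \<in> W" and s: "0 \<le> (s::real) \<and> s \<le> 1"
    then obtain x y t x' y' t' where w: "w = (A x + B y, t)" "x \<in> P" "y \<in> Q" "t < l \<bullet> x"
      and w': "w' = (A x' + B y', t')" "x' \<in> P" "y' \<in> Q" "t' < l \<bullet> x'"
      unfolding W_def by blast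
    have "(1 - s) *\<^sub>R x + s *\<^sub>R x' \<in> P" "(1 - s) *\<^sub>R y + s *\<^sub>R y' \<in> Q"
      using assms(1,2) w w' s by (auto simp: convex_alt)
    moreover have "(1 - s) * t + s * t' < l \<bullet> ((1 - s) *\<^sub>R x + s *\<^sub>R x')"
    \<comment> \<open>Strictness is taken from the second point, whose weight vanishes when
      \<open>s = 0\<close>.\<close>
    proof (cases "s = 0")
      case False
      have "(1 - s) * t \<le> (1 - s) * (l \<bullet> x)" "s * t' < s * (l \<bullet> x')"
        using w w' s False by (auto intro: mult_left_mono)
      then show ?thesis by (simp add: inner_add_right)
    qed (use w in simp)
    moreover have "(1 - s) *\<^sub>R w + s *\<^sub>R w' = (A ((1 - s) *\<^sub>R x + s *\<^sub>R x') + B ((1 - s) *\<^sub>R y + s *\<^sub>R y'),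
        (1 - s) * t + s * t')"
      unfolding w w' by (simp add: linear_add[OF lin_A] linear_add[OF lin_B]
          linear_diff[OF lin_A] linear_diff[OF lin_B] linear_scale[OF lin_A] linear_scale[OF lin_B] algebra_simps)
    ultimately show "(1 - s) *\<^sub>R w + s *\<^sub>R w' \<in> W" unfolding W_def by blast
  qed
  moreover have "(0, l \<bullet> p - 1) \<in> W"
    unfolding W_def using opt(1-3) by force
  then have "W \<noteq> {}" by blast
  moreover have "W \<inter> {(0, l \<bullet> p)} = {}"
    using opt(4) unfolding W_def by fastforce
  ultimately obtain ab \<beta> where ab: "ab \<noteq> 0" "\<forall>w\<in>W. ab \<bullet> w \<le> \<beta>" "\<beta> \<le> ab \<bullet> (0, l \<bullet> p)"
    using separating_hyperplane_sets[of W "{(0, l \<bullet> p)}"] by fastforce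
  obtain a b where [simp]: "ab = (a, b)" by (cases ab)
  have sep: "a \<bullet> (A x + B y) + b * t \<le> b * (l \<bullet> p)" if "x \<in> P" "y \<in> Q" "t < l \<bullet> x" for x y t
    using ab(2,3) that by (force simp: W_def)
  have b_nonneg: "0 \<le> b"
    using sep[OF opt(1,2), of "l \<bullet> p - 1"] opt(3) by (simp add: algebra_simps)
  have "b \<noteq> 0"
  proof
    assume b0: "b = 0"
    then have "a \<noteq> 0" using ab(1) by (simp add: zero_prod_def)
    \<comment> \<open>The multiple of \<open>a\<close> of length \<open>e / 2\<close> has positive
      inner product with \<open>a\<close>, against \<open>sep\<close> with
      \<open>b = 0\<close>.\<close>
    then have "(e / 2 / norm a) *\<^sub>R a \<in> ball 0 e" using slater(1) by simp
    then obtain x y where xy: "x \<in> P" "y \<in> Q" "(e / 2 / norm a) *\<^sub>R a = A x + B y"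
      using slater(2) by blast
    have "a \<bullet> (A x + B y) \<le> 0" using sep[OF xy(1,2), of "l \<bullet> x - 1"] b0 by simp
    then have "(e / 2 / norm a) * (norm a)\<^sup>2 \<le> 0"
      unfolding xy(3)[symmetric] by (simp add: power2_norm_eq_inner)
    moreover have "(e / 2 / norm a) * (norm a)\<^sup>2 > 0" using slater(1) \<open>a \<noteq> 0\<close> by simp
    ultimately show False by linarith
  qed
  with b_nonneg have b: "b > 0" by simp
  define u where "u = (1 / b) *\<^sub>R a"
  \<comment> \<open>The strict bound on \<open>t\<close> is removed by letting \<open>t\<close>
    approach \<open>l \<bullet> x\<close>.\<close>
  have main: "u \<bullet> (A x + B y) + l \<bullet> x \<le> l \<bullet> p" if "x \<in> P" "y \<in> Q" for x y
  proof (rule field_le_epsilon)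
    fix d :: real assume "d > 0"
    then show "u \<bullet> (A x + B y) + l \<bullet> x \<le> l \<bullet> p + d"
      using sep[OF that, of "l \<bullet> x - d"] b by (simp add: u_def field_simps)
  qed
  have "A p = - B q" using opt(3) by (simp add: eq_neg_iff_add_eq_0)
  \<comment> \<open>Setting \<open>y = q\<close> or \<open>x = p\<close> in \<open>main\<close>
    separates the two stationarity conditions.\<close>
  then have "kkt q p u"
    unfolding kkt_def using opt(1,2) main[OF _ opt(2)] main[OF opt(1)]
    by (auto simp: linear_diff[OF lin_A] linear_diff[OF lin_B] inner_diff_right inner_add_right algebra_simps)
  then show ?thesis ..
qed

end

section \<open>Descent of the Lyapunov function\<close>

text \<open>The resolvent steps enter as variational inequalities, with \<open>N\<close> and
  \<open>M\<close> the multiples \<open>n\<close> and \<open>m\<close> of the identity. The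
  multiplier in \<open>p_step\<close> is already \<open>u (Suc k)\<close>, because
  \<open>u_step\<close> absorbs all terms of the \<open>p\<close>-step that contain
  \<open>\<rho> k\<close>. Membership in \<open>P\<close> and \<open>Q\<close> begins at index 1,
  the starting point being arbitrary.\<close>

locale relaxed_admm = constrained_problem A B l P Q
  for A :: "'p::euclidean_space \<Rightarrow> 'x::euclidean_space" and B :: "'q::euclidean_space \<Rightarrow> 'x"
    and l P Q +
  fixes c m n :: real and \<rho> :: "nat \<Rightarrow> real"
    and q :: "nat \<Rightarrow> 'q" and p :: "nat \<Rightarrow> 'p" and u :: "nat \<Rightarrow> 'x"
  assumes c_pos: "c > 0" and m_pos: "m > 0" and n_pos: "n > 0"
    and m_ge: "\<And>x. c * (A x \<bullet> A x) \<le> m * (x \<bullet> x)"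
    and n_ge: "\<And>x. c * (B x \<bullet> B x) \<le> n * (x \<bullet> x)"
    and rho_mono: "mono \<rho>" and rho: "\<And>k. 0 < \<rho> k" "\<And>k. \<rho> k < 2"
    and closed: "closed P" "closed Q" and bounded_Q: "bounded Q"
    and q_in: "\<And>k. q (Suc k) \<in> Q" and p_in: "\<And>k. p (Suc k) \<in> P"
    and q_step: "\<And>k x. x \<in> Q \<Longrightarrow>
      (u k - c *\<^sub>R (A (p k) + B (q (Suc k)))) \<bullet> B (x - q (Suc k))
       \<le> n * ((q (Suc k) - q k) \<bullet> (x - q (Suc k))) - c * (B (q (Suc k) - q k) \<bullet> B (x - q (Suc k)))"
    and p_step: "\<And>k x. x \<in> P \<Longrightarrow>
      l \<bullet> (x - p (Suc k)) + u (Suc k) \<bullet> A (x - p (Suc k))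
       \<le> m * ((p (Suc k) - p k) \<bullet> (x - p (Suc k))) - c * (A (p (Suc k) - p k) \<bullet> A (x - p (Suc k)))"
    and u_step: "\<And>k. u (Suc k) = u k - c *\<^sub>R (A (p (Suc k)) - (1 - \<rho> k) *\<^sub>R A (p k) + \<rho> k *\<^sub>R B (q (Suc k)))"
begin

section \<open>Seminorms of the proximal terms, residual and Lyapunov function\<close>

definition pform :: "'p \<Rightarrow> 'p \<Rightarrow> real" where "pform x y = m * (x \<bullet> y) - c * (A x \<bullet> A y)"
definition qform :: "'q \<Rightarrow> 'q \<Rightarrow> real" where "qform x y = n * (x \<bullet> y) - c * (B x \<bullet> B y)"
definition res :: "nat \<Rightarrow> 'x" where "res k = A (p k) + B (q (Suc k))"
definition z :: "nat \<Rightarrow> 'x" where "z k = u k + c *\<^sub>R A (p k)"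
text \<open>The index is shifted so that \<open>p\<close> can lag by one within the natural numbers.
  The lag lets the \<open>p\<close>-inequality of step \<open>k\<close> meet the
  \<open>q\<close>-inequality of step \<open>Suc k\<close>: both contain
  \<open>u (Suc k)\<close>.\<close>

definition lyap :: "'q \<Rightarrow> 'p \<Rightarrow> 'x \<Rightarrow> nat \<Rightarrow> real" where
  "lyap qs ps us k = (norm (z (Suc k) - (us + c *\<^sub>R A ps)))\<^sup>2 / (c * \<rho> (Suc k))
     + qform (q (Suc k) - qs) (q (Suc k) - qs) + pform (p k - ps) (p k - ps)"
definition decr :: "nat \<Rightarrow> real" where
  "decr k = qform (q (Suc (Suc k)) - q (Suc k)) (q (Suc (Suc k)) - q (Suc k))
     + pform (p (Suc k) - p k) (p (Suc k) - p k) + (2 - \<rho> (Suc k)) * c * (norm (res (Suc k)))\<^sup>2"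

lemmas lin = linear_add[OF lin_A] linear_diff[OF lin_A] linear_scale[OF lin_A]
  linear_add[OF lin_B] linear_diff[OF lin_B] linear_scale[OF lin_B]
  linear_0[OF lin_A] linear_0[OF lin_B] linear_neg[OF lin_A] linear_neg[OF lin_B]

lemma bilinear_pform: "bilinear pform"
  unfolding bilinear_def pform_def
  by (auto intro!: linearI simp: lin inner_add_left inner_add_right algebra_simps)

lemma bilinear_qform: "bilinear qform"
  unfolding bilinear_def qform_def
  by (auto intro!: linearI simp: lin inner_add_left inner_add_right algebra_simps)

lemma pform_sym: "pform x y = pform y x" and qform_sym: "qform v w = qform w v"
  by (simp_all add: pform_def qform_def inner_commute)

lemma pform_nonneg: "0 \<le> pform x x" and qform_nonneg: "0 \<le> qform v v"
  using m_ge[of x] n_ge[of v] by (simp_all add: pform_def qform_def)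

lemma pform_polar: "2 * pform (y - x) (y - w) = pform (y - w) (y - w) - pform (x - w) (x - w) + pform (y - x) (y - x)"
  by (simp add: pform_def lin inner_diff_left inner_diff_right inner_commute algebra_simps)

lemma qform_polar: "2 * qform (y - x) (y - w) = qform (y - w) (y - w) - qform (x - w) (x - w) + qform (y - x) (y - x)"
  by (simp add: qform_def lin inner_diff_left inner_diff_right inner_commute algebra_simps)

lemma bounded_linear_AB: "bounded_linear A" "bounded_linear B"
  using lin_A lin_B unfolding linear_conv_bounded_linear .

lemmas tendsto_AB = bounded_linear.tendsto[OF bounded_linear_AB(1)]
  bounded_linear.tendsto[OF bounded_linear_AB(2)]

lemma tendsto_pform:
  "(f \<longlongrightarrow> a) F \<Longrightarrow> (g \<longlongrightarrow> b) F \<Longrightarrow> ((\<lambda>x. pform (f x) (g x)) \<longlongrightarrow> pform a b) F"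
  unfolding pform_def by (intro tendsto_intros tendsto_AB)

lemma tendsto_qform:
  "(f \<longlongrightarrow> a) F \<Longrightarrow> (g \<longlongrightarrow> b) F \<Longrightarrow> ((\<lambda>x. qform (f x) (g x)) \<longlongrightarrow> qform a b) F"
  unfolding qform_def by (intro tendsto_intros tendsto_AB)

lemma p_step': "x \<in> P \<Longrightarrow> l \<bullet> (x - p (Suc k)) + u (Suc k) \<bullet> A (x - p (Suc k)) \<le> pform (p (Suc k) - p k) (x - p (Suc k))"
  using p_step by (simp add: pform_def)

lemma q_step': "x \<in> Q \<Longrightarrow> (u k - c *\<^sub>R res k) \<bullet> B (x - q (Suc k)) \<le> qform (q (Suc k) - q k) (x - q (Suc k))"
  using q_step by (simp add: qform_def res_def)

text \<open>\<open>A (p (Suc k))\<close> cancels, so \<open>z\<close> is moved by the residual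
  alone.\<close>

lemma z_step: "z (Suc k) = z k - (c * \<rho> k) *\<^sub>R res k"
  by (simp add: z_def res_def u_step algebra_simps)

section \<open>Monotonicity inequalities and one-step descent\<close>

text \<open>Monotonicity of the normal cone of \<open>P\<close>: iterate and KKT point serve as test
  points for each other, and polarization rewrites the proximal term.\<close>

lemma p_monotone:
  assumes "kkt qs ps us"
  shows "pform (p (Suc k) - ps) (p (Suc k) - ps) - pform (p k - ps) (p k - ps)
      + pform (p (Suc k) - p k) (p (Suc k) - p k) \<le> 2 * ((u (Suc k) - us) \<bullet> A (p (Suc k) - ps))"
proof -
  have "l \<bullet> (ps - p (Suc k)) + u (Suc k) \<bullet> A (ps - p (Suc k)) \<le> pform (p (Suc k) - p k) (ps - p (Suc k))"
    using assms by (intro p_step') (simp add: kkt_def)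
  moreover have "l \<bullet> (p (Suc k) - ps) + us \<bullet> A (p (Suc k) - ps) \<le> 0"
    using assms p_in by (simp add: kkt_def)
  moreover have "pform (p (Suc k) - p k) (ps - p (Suc k)) = - pform (p (Suc k) - p k) (p (Suc k) - ps)"
    by (simp add: pform_def lin inner_diff_right algebra_simps)
  ultimately show ?thesis
    unfolding pform_polar[symmetric] by (simp add: lin inner_diff_left inner_diff_right)
qed

text \<open>As for \<open>p\<close>, except that the multiplier seen by the \<open>q\<close>-step is
  \<open>u k - c *\<^sub>R res k\<close>.\<close>

lemma q_monotone:
  assumes "kkt qs ps us"
  shows "qform (q (Suc k) - qs) (q (Suc k) - qs) - qform (q k - qs) (q k - qs)
      + qform (q (Suc k) - q k) (q (Suc k) - q k) \<le> 2 * ((u k - us - c *\<^sub>R res k) \<bullet> B (q (Suc k) - qs))"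
proof -
  have "(u k - c *\<^sub>R res k) \<bullet> B (qs - q (Suc k)) \<le> qform (q (Suc k) - q k) (qs - q (Suc k))"
    using assms by (intro q_step') (simp add: kkt_def)
  moreover have "us \<bullet> B (q (Suc k) - qs) \<le> 0"
    using assms q_in by (simp add: kkt_def)
  moreover have "qform (q (Suc k) - q k) (qs - q (Suc k)) = - qform (q (Suc k) - q k) (q (Suc k) - qs)"
    by (simp add: qform_def lin inner_diff_right algebra_simps)
  ultimately show ?thesis
    unfolding qform_polar[symmetric] by (simp add: lin inner_diff_left inner_diff_right)
qed

lemma lyap_nonneg: "0 \<le> lyap qs ps us k"
  unfolding lyap_def using c_pos rho(1)[of "Suc k"] pform_nonneg qform_nonneg by simp

lemma decr_nonneg: "0 \<le> decr k"
  unfolding decr_def using c_pos rho(2)[of "Suc k"] pform_nonneg qform_nonneg by simp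

lemma lyap_descent:
  assumes kkt: "kkt qs ps us"
  shows "lyap qs ps us (Suc k) + decr k \<le> lyap qs ps us k"
proof -
  define K r v a b Z where defs: "K = Suc k" "r = res K" "v = u K - us" "a = A (p K - ps)"
    "b = B (q (Suc K) - qs)" "Z = v + c *\<^sub>R a"
  have "A ps + B qs = 0" using kkt by (simp add: kkt_def)
  then have r: "r = a + b" by (simp add: defs res_def lin add_eq_0_iff)
  have Z: "z K - (us + c *\<^sub>R A ps) = Z" by (simp add: defs z_def lin algebra_simps)
  have Z': "z (Suc K) - (us + c *\<^sub>R A ps) = Z - (c * \<rho> K) *\<^sub>R r"
    unfolding z_step[of K] Z[symmetric] by (simp add: defs)
  \<comment> \<open>\<open>2 * E\<close> is the sum of the right-hand sides of
    \<open>p_monotone\<close> at \<open>k\<close> and \<open>q_monotone\<close> at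
    \<open>K\<close>.\<close>
  define E where "E = (v - c *\<^sub>R r) \<bullet> b + v \<bullet> a"
  have ZrE: "Z \<bullet> r = E + c * (r \<bullet> r)"
    by (simp add: E_def defs(6) r inner_add_left inner_add_right inner_diff_left inner_commute algebra_simps)
  have "(norm (Z - (c * \<rho> K) *\<^sub>R r))\<^sup>2 = (norm Z)\<^sup>2 - 2 * (c * \<rho> K) * (Z \<bullet> r) + (c * \<rho> K)\<^sup>2 * (r \<bullet> r)"
    unfolding power2_norm_eq_inner
    by (simp add: inner_diff_left inner_diff_right inner_commute power2_eq_square algebra_simps)
  also have "\<dots> = (norm Z)\<^sup>2 - (c * \<rho> K) * (2 * E + (2 - \<rho> K) * c * (r \<bullet> r))"
    unfolding ZrE by (simp add: power2_eq_square algebra_simps)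
  finally have "(norm (Z - (c * \<rho> K) *\<^sub>R r))\<^sup>2 / (c * \<rho> K) = (norm Z)\<^sup>2 / (c * \<rho> K) - (2 * E + (2 - \<rho> K) * c * (r \<bullet> r))"
    using c_pos rho(1)[of K] by (simp add: field_simps)
  \<comment> \<open>Monotonicity of \<rho> enters here: the weight of the next step is not
    larger.\<close>
  moreover have "(norm (Z - (c * \<rho> K) *\<^sub>R r))\<^sup>2 / (c * \<rho> (Suc K)) \<le> (norm (Z - (c * \<rho> K) *\<^sub>R r))\<^sup>2 / (c * \<rho> K)"
    using c_pos rho(1)[of K] rho(1)[of "Suc K"] monoD[OF rho_mono, of K "Suc K"]
    by (intro divide_left_mono mult_left_mono) auto
  moreover have "2 * E = 2 * ((v - c *\<^sub>R r) \<bullet> b) + 2 * (v \<bullet> a)" by (simp add: E_def)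
  moreover note p_monotone[OF kkt, of k] q_monotone[OF kkt, of K]
  ultimately show ?thesis
    unfolding lyap_def decr_def defs(1)[symmetric] Z Z'
    by (simp add: defs power2_norm_eq_inner)
qed

lemma lyap_le_0:
  assumes "kkt qs ps us" shows "lyap qs ps us k \<le> lyap qs ps us 0"
proof (induction k)
  case (Suc k)
  then show ?case using lyap_descent[OF assms, of k] decr_nonneg[of k] by linarith
qed simp

lemma decr_tendsto:
  assumes "kkt qs ps us"
  shows "decr \<longlonglongrightarrow> 0" "convergent (lyap qs ps us)"
  using decseq_nonneg_diff_tendsto_0[of "lyap qs ps us" decr] lyap_nonneg decr_nonneg lyap_descent[OF assms]
  by blast+

text \<open>\<open>lyap\<close> sees \<open>u\<close> and \<open>A p\<close> only through
  \<open>z\<close>. A lower bound on their cross term, from \<open>p_monotone\<close>, separates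
  them; the norm of \<open>p\<close> then follows because \<open>m * (norm x)\<^sup>2\<close> is
  \<open>pform x x\<close> plus \<open>c * (norm (A x))\<^sup>2\<close>.\<close>

lemma lyap_parts:
  assumes kkt: "kkt qs ps us"
  shows "(norm (z (Suc k) - (us + c *\<^sub>R A ps)))\<^sup>2 \<le> 2 * c * lyap qs ps us k"
    "qform (q (Suc k) - qs) (q (Suc k) - qs) \<le> lyap qs ps us k"
    "pform (p k - ps) (p k - ps) \<le> lyap qs ps us k"
    "(norm (u (Suc k) - us))\<^sup>2 + c\<^sup>2 * (norm (A (p (Suc k) - ps)))\<^sup>2 \<le> 3 * c * lyap qs ps us k"
    "m * (norm (p (Suc k) - ps))\<^sup>2 \<le> lyap qs ps us (Suc k) + 3 * lyap qs ps us k"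
proof -
  let ?Z = "z (Suc k) - (us + c *\<^sub>R A ps)"
  have pos: "0 \<le> (norm ?Z)\<^sup>2 / (c * \<rho> (Suc k))" using c_pos rho(1)[of "Suc k"] by simp
  have "(norm ?Z)\<^sup>2 = (c * \<rho> (Suc k)) * ((norm ?Z)\<^sup>2 / (c * \<rho> (Suc k)))"
    using c_pos rho(1)[of "Suc k"] by simp
  also have "\<dots> \<le> (2 * c) * ((norm ?Z)\<^sup>2 / (c * \<rho> (Suc k)))"
    using c_pos rho(2)[of "Suc k"] pos by (intro mult_right_mono) auto
  also have "\<dots> \<le> 2 * c * lyap qs ps us k"
    using c_pos pform_nonneg qform_nonneg by (intro mult_left_mono) (simp_all add: lyap_def)
  finally show 1: "(norm ?Z)\<^sup>2 \<le> 2 * c * lyap qs ps us k" .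
  show "qform (q (Suc k) - qs) (q (Suc k) - qs) \<le> lyap qs ps us k"
    unfolding lyap_def using pos pform_nonneg[of "p k - ps"] by simp
  show 3: "pform (p k - ps) (p k - ps) \<le> lyap qs ps us k" for k
    unfolding lyap_def using c_pos rho(1)[of "Suc k"] qform_nonneg[of "q (Suc k) - qs"] by simp
  define v a where "v = u (Suc k) - us" and "a = A (p (Suc k) - ps)"
  have "?Z = v + c *\<^sub>R a" by (simp add: v_def a_def z_def lin algebra_simps)
  then have "(norm ?Z)\<^sup>2 = (norm v)\<^sup>2 + c\<^sup>2 * (norm a)\<^sup>2 + c * (2 * (v \<bullet> a))"
    unfolding power2_norm_eq_inner
    by (simp add: inner_add_left inner_add_right inner_commute power2_eq_square algebra_simps)
  moreover have "- lyap qs ps us k \<le> 2 * (v \<bullet> a)"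
    using p_monotone[OF kkt, of k] 3[of k] pform_nonneg[of "p (Suc k) - p k"] pform_nonneg[of "p (Suc k) - ps"]
    unfolding v_def a_def by linarith
  then have "c * (- lyap qs ps us k) \<le> c * (2 * (v \<bullet> a))"
    using c_pos by (intro mult_left_mono) auto
  ultimately show 4: "(norm (u (Suc k) - us))\<^sup>2 + c\<^sup>2 * (norm (A (p (Suc k) - ps)))\<^sup>2 \<le> 3 * c * lyap qs ps us k"
    using 1 unfolding v_def[symmetric] a_def[symmetric] by (simp add: algebra_simps)
  have "c * (c * (norm a)\<^sup>2) \<le> c * (3 * lyap qs ps us k)"
    using 4 zero_le_power2[of "norm v"] unfolding v_def[symmetric] a_def[symmetric]
    by (simp only: power2_eq_square[of c] mult.assoc mult.left_commute[of 3 c])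
  then have "c * (norm a)\<^sup>2 \<le> 3 * lyap qs ps us k" using c_pos by simp
  then show "m * (norm (p (Suc k) - ps))\<^sup>2 \<le> lyap qs ps us (Suc k) + 3 * lyap qs ps us k"
    using 3[of "Suc k"] by (simp add: pform_def a_def power2_norm_eq_inner)
qed

section \<open>Convergence\<close>

lemma rho_limit: obtains r where "\<rho> \<longlonglongrightarrow> r" "0 < r" "r \<le> 2"
proof -
  obtain r where r: "\<rho> \<longlonglongrightarrow> r"
    using incseq_convergent[OF rho_mono, of 2] rho(2) by (meson less_imp_le)
  have "\<rho> 0 \<le> r" by (rule incseq_le[OF rho_mono r])
  moreover have "r \<le> 2" by (rule LIMSEQ_le_const2[OF r]) (use rho(2) in \<open>auto intro: less_imp_le\<close>)
  ultimately show ?thesis using that[OF r] rho(1)[of 0] by simp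
qed

text \<open>\<open>u\<close> and \<open>p\<close> are controlled by the decreasing
  \<open>lyap\<close>, which bounds \<open>q\<close> only in a seminorm; for \<open>q\<close> the
  bound comes from \<open>Q\<close>.\<close>

lemma bounded_iterates:
  assumes kkt: "kkt qs ps us"
  shows "bounded (range (\<lambda>k. (q (Suc k), p (Suc k), u (Suc k))))"
proof -
  let ?L = "lyap qs ps us 0"
  have "u (Suc k) \<in> cball us (sqrt (3 * c * ?L))" for k
  proof -
    have "(norm (u (Suc k) - us))\<^sup>2 \<le> 3 * c * lyap qs ps us k"
      using lyap_parts(4)[OF kkt, of k]
        mult_nonneg_nonneg[OF zero_le_power2[of c] zero_le_power2[of "norm (A (p (Suc k) - ps))"]] by linarith
    also have "\<dots> \<le> 3 * c * ?L" using lyap_le_0[OF kkt, of k] c_pos by simp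
    finally show ?thesis by (simp add: dist_norm norm_minus_commute real_le_rsqrt)
  qed
  moreover have "p (Suc k) \<in> cball ps (sqrt (4 * ?L / m))" for k
  proof -
    have "m * (norm (p (Suc k) - ps))\<^sup>2 \<le> 4 * ?L"
      using lyap_parts(5)[OF kkt, of k] lyap_le_0[OF kkt, of k] lyap_le_0[OF kkt, of "Suc k"] by linarith
    then have "(norm (p (Suc k) - ps))\<^sup>2 \<le> 4 * ?L / m" using m_pos by (simp add: field_simps)
    then show ?thesis by (simp add: dist_norm norm_minus_commute real_le_rsqrt)
  qed
  ultimately have "range (\<lambda>k. (q (Suc k), p (Suc k), u (Suc k)))
      \<subseteq> Q \<times> cball ps (sqrt (4 * ?L / m)) \<times> cball us (sqrt (3 * c * ?L))"
    using q_in by blast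
  then show ?thesis by (rule bounded_subset[rotated]) (intro bounded_Times bounded_Q bounded_cball)
qed

section \<open>Limits of consecutive iterates\<close>

text \<open>Null vectors of a semidefinite form lie in its radical, by Cauchy-Schwarz; this removes
  the proximal terms from limit inequalities.\<close>

lemma pform_zero: "pform d d = 0 \<Longrightarrow> pform d x = 0"
  using psd_form_cauchy_schwarz[OF bilinear_pform pform_sym pform_nonneg, of d x] by simp

lemma qform_zero: "qform d d = 0 \<Longrightarrow> qform d x = 0"
  using psd_form_cauchy_schwarz[OF bilinear_qform qform_sym qform_nonneg, of d x] by simp

lemma pform_shift: "pform d d = 0 \<Longrightarrow> pform (x + d) (x + d) = pform x x"
  using pform_zero[of d] pform_sym[of x d] bilinear_pform
  by (simp add: bilinear_ladd bilinear_radd)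

text \<open>Since \<open>decr\<close> tends to 0, increments between limit states are null for the
  seminorms. The step inequalities therefore pass to the limit with right-hand side 0.\<close>

lemma limit_window:
  fixes h :: "nat \<Rightarrow> nat"
  assumes kkt: "kkt qs ps us" and h: "strict_mono h"
    and lim: "\<forall>i<N. (\<lambda>k. (q (Suc (h k + i)), p (Suc (h k + i)), u (Suc (h k + i)))) \<longlonglongrightarrow> (qq i, pp i, uu i)"
    and i: "Suc i < N"
  shows "pp i \<in> P" "qq i \<in> Q"
    "qform (qq (Suc i) - qq i) (qq (Suc i) - qq i) = 0"
    "pform (pp (Suc i) - pp i) (pp (Suc i) - pp i) = 0"
    "x \<in> P \<Longrightarrow> l \<bullet> (x - pp (Suc i)) + uu (Suc i) \<bullet> A (x - pp (Suc i)) \<le> 0"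
    "y \<in> Q \<Longrightarrow> (uu i - c *\<^sub>R (A (pp i) + B (qq (Suc i)))) \<bullet> B (y - qq (Suc i)) \<le> 0"
    "\<rho> \<longlonglongrightarrow> r \<Longrightarrow> uu (Suc i) = uu i - c *\<^sub>R (A (pp (Suc i)) - (1 - r) *\<^sub>R A (pp i) + r *\<^sub>R B (qq (Suc i)))"
proof -
  have q: "(\<lambda>k. q (Suc (h k + j))) \<longlonglongrightarrow> qq j" and p: "(\<lambda>k. p (Suc (h k + j))) \<longlonglongrightarrow> pp j"
    and u: "(\<lambda>k. u (Suc (h k + j))) \<longlonglongrightarrow> uu j" if "j < N" for j
    using tendsto_fst[OF lim[rule_format, OF that]] tendsto_fst[OF tendsto_snd[OF lim[rule_format, OF that]]]
      tendsto_snd[OF tendsto_snd[OF lim[rule_format, OF that]]] by simp_all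
  have i': "i < N" using i by simp
  note Q0 = q[OF i'] and P0 = p[OF i'] and U0 = u[OF i']
  have Q1: "(\<lambda>k. q (Suc (Suc (h k + i)))) \<longlonglongrightarrow> qq (Suc i)"
    and P1: "(\<lambda>k. p (Suc (Suc (h k + i)))) \<longlonglongrightarrow> pp (Suc i)"
    and U1: "(\<lambda>k. u (Suc (Suc (h k + i)))) \<longlonglongrightarrow> uu (Suc i)"
    using q[OF i] p[OF i] u[OF i] by simp_all
  have subseq: "(\<lambda>k. X (h k + j)) \<longlonglongrightarrow> a" if "X \<longlonglongrightarrow> a" for X :: "nat \<Rightarrow> real" and a j
    using LIMSEQ_subseq_LIMSEQ[OF LIMSEQ_ignore_initial_segment[OF that, of j] h] by (simp add: o_def)
  have decr0: "(\<lambda>k. decr (h k + j)) \<longlonglongrightarrow> 0" for j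
    by (rule subseq[OF decr_tendsto(1)[OF kkt]])
  have decr_ge: "qform (q (Suc (Suc k)) - q (Suc k)) (q (Suc (Suc k)) - q (Suc k)) \<le> decr k"
    "pform (p (Suc k) - p k) (p (Suc k) - p k) \<le> decr k" for k
    using pform_nonneg[of "p (Suc k) - p k"] qform_nonneg[of "q (Suc (Suc k)) - q (Suc k)"]
      c_pos rho(2)[of "Suc k"] unfolding decr_def by simp_all
  show "pp i \<in> P" by (rule closed_sequentially[OF closed(1) _ P0]) (rule p_in)
  show "qq i \<in> Q" by (rule closed_sequentially[OF closed(2) _ Q0]) (rule q_in)
  have "qform (qq (Suc i) - qq i) (qq (Suc i) - qq i) \<le> 0"
    by (rule LIMSEQ_le[OF tendsto_qform[OF tendsto_diff[OF Q1 Q0] tendsto_diff[OF Q1 Q0]] decr0[of i]])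
       (use decr_ge(1) in auto)
  then show qz: "qform (qq (Suc i) - qq i) (qq (Suc i) - qq i) = 0"
    using qform_nonneg by (simp add: order_antisym)
  \<comment> \<open>In \<open>decr\<close> the \<open>p\<close>-increment lags one step behind the
    \<open>q\<close>-increment, hence the index \<open>Suc i\<close>.\<close>
  have "pform (pp (Suc i) - pp i) (pp (Suc i) - pp i) \<le> 0"
    by (rule LIMSEQ_le[OF tendsto_pform[OF tendsto_diff[OF P1 P0] tendsto_diff[OF P1 P0]] decr0[of "Suc i"]])
       (use decr_ge(2) in auto)
  then show pz: "pform (pp (Suc i) - pp i) (pp (Suc i) - pp i) = 0"
    using pform_nonneg by (simp add: order_antisym)
  show "l \<bullet> (x - pp (Suc i)) + uu (Suc i) \<bullet> A (x - pp (Suc i)) \<le> 0" if "x \<in> P"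
  proof -
    have "l \<bullet> (x - pp (Suc i)) + uu (Suc i) \<bullet> A (x - pp (Suc i)) \<le> pform (pp (Suc i) - pp i) (x - pp (Suc i))"
    proof (rule LIMSEQ_le)
      show "(\<lambda>k. l \<bullet> (x - p (Suc (Suc (h k + i)))) + u (Suc (Suc (h k + i))) \<bullet> A (x - p (Suc (Suc (h k + i)))))
        \<longlonglongrightarrow> l \<bullet> (x - pp (Suc i)) + uu (Suc i) \<bullet> A (x - pp (Suc i))"
        by (intro tendsto_intros tendsto_AB P1 U1)
      show "(\<lambda>k. pform (p (Suc (Suc (h k + i))) - p (Suc (h k + i))) (x - p (Suc (Suc (h k + i)))))
        \<longlonglongrightarrow> pform (pp (Suc i) - pp i) (x - pp (Suc i))"
        by (intro tendsto_intros tendsto_pform P1 P0)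
    qed (use p_step'[OF that] in auto)
    then show ?thesis using pform_zero[OF pz] by simp
  qed
  show "(uu i - c *\<^sub>R (A (pp i) + B (qq (Suc i)))) \<bullet> B (y - qq (Suc i)) \<le> 0" if "y \<in> Q"
  proof -
    have "(uu i - c *\<^sub>R (A (pp i) + B (qq (Suc i)))) \<bullet> B (y - qq (Suc i)) \<le> qform (qq (Suc i) - qq i) (y - qq (Suc i))"
    proof (rule LIMSEQ_le)
      show "(\<lambda>k. (u (Suc (h k + i)) - c *\<^sub>R (A (p (Suc (h k + i))) + B (q (Suc (Suc (h k + i)))))) \<bullet> B (y - q (Suc (Suc (h k + i)))))
        \<longlonglongrightarrow> (uu i - c *\<^sub>R (A (pp i) + B (qq (Suc i)))) \<bullet> B (y - qq (Suc i))"
        by (intro tendsto_intros tendsto_AB P0 U0 Q1)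
      show "(\<lambda>k. qform (q (Suc (Suc (h k + i))) - q (Suc (h k + i))) (y - q (Suc (Suc (h k + i)))))
        \<longlonglongrightarrow> qform (qq (Suc i) - qq i) (y - qq (Suc i))"
        by (intro tendsto_intros tendsto_qform Q1 Q0)
    qed (use q_step'[OF that] in \<open>auto simp: res_def\<close>)
    then show ?thesis using qform_zero[OF qz] by simp
  qed
  show "uu (Suc i) = uu i - c *\<^sub>R (A (pp (Suc i)) - (1 - r) *\<^sub>R A (pp i) + r *\<^sub>R B (qq (Suc i)))"
    if "\<rho> \<longlonglongrightarrow> r"
  proof (rule LIMSEQ_unique[OF U1])
    have "(\<lambda>k. \<rho> (Suc (h k + i))) \<longlonglongrightarrow> r" using subseq[OF that, of "Suc i"] by simp
    then show "(\<lambda>k. u (Suc (Suc (h k + i)))) \<longlonglongrightarrow>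
        uu i - c *\<^sub>R (A (pp (Suc i)) - (1 - r) *\<^sub>R A (pp i) + r *\<^sub>R B (qq (Suc i)))"
      unfolding u_step[where k = "Suc (h k + i)" for k] by (intro tendsto_intros tendsto_AB P0 P1 U0 Q1)
  qed
qed

lemma convergent_window_iterates:
  fixes f :: "nat \<Rightarrow> nat"
  assumes kkt: "kkt qs ps us" and f: "strict_mono f"
  obtains g qq pp uu where "strict_mono (g::nat\<Rightarrow>nat)" "strict_mono (\<lambda>k. f (g k))"
    "\<And>i. i < N \<Longrightarrow> (\<lambda>k. (q (Suc (f (g k) + i)), p (Suc (f (g k) + i)), u (Suc (f (g k) + i)))) \<longlonglongrightarrow> (qq i, pp i, uu i)"
proof -
  obtain g L where g: "strict_mono (g::nat\<Rightarrow>nat)"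
    and L: "\<forall>i<N. (\<lambda>k. (q (Suc (f (g k) + i)), p (Suc (f (g k) + i)), u (Suc (f (g k) + i)))) \<longlonglongrightarrow> L i"
    using convergent_window[OF bounded_iterates[OF kkt], where f = f and N = N] by blast
  show ?thesis
  proof (rule that[OF g, of "\<lambda>i. fst (L i)" "\<lambda>i. fst (snd (L i))" "\<lambda>i. snd (snd (L i))"])
    show "strict_mono (\<lambda>k. f (g k))" using strict_mono_o[OF f g] by (simp add: o_def)
  qed (use L in simp)
qed

text \<open>The limit of \<open>p (h k)\<close> is a separate datum because \<open>p\<close> lags in
  \<open>lyap\<close>.\<close>

lemma lyap_limit:
  assumes "\<rho> \<longlonglongrightarrow> r" "0 < r" "strict_mono h"
    and Q: "(\<lambda>k. q (Suc (h k))) \<longlonglongrightarrow> q1" and P: "(\<lambda>k. p (Suc (h k))) \<longlonglongrightarrow> p1"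
    and U: "(\<lambda>k. u (Suc (h k))) \<longlonglongrightarrow> u1" and P0: "(\<lambda>k. p (h k)) \<longlonglongrightarrow> p0"
  shows "(\<lambda>k. lyap qs ps us (h k)) \<longlonglongrightarrow>
    (norm (u1 + c *\<^sub>R A p1 - (us + c *\<^sub>R A ps)))\<^sup>2 / (c * r) + qform (q1 - qs) (q1 - qs) + pform (p0 - ps) (p0 - ps)"
proof -
  have "(\<lambda>k. \<rho> (Suc (h k))) \<longlonglongrightarrow> r"
    using LIMSEQ_subseq_LIMSEQ[OF LIMSEQ_Suc[OF assms(1)] assms(3)] by (simp add: o_def)
  then show ?thesis
    unfolding lyap_def z_def using c_pos assms(2)
    by (intro tendsto_intros tendsto_AB tendsto_pform tendsto_qform Q P U P0) auto
qed

theorem convergence: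
  assumes kkt0: "kkt q0 p0 u0" and res: "res \<longlonglongrightarrow> 0"
  shows "\<exists>qs ps us. kkt qs ps us \<and> q \<longlonglongrightarrow> qs \<and> p \<longlonglongrightarrow> ps \<and> u \<longlonglongrightarrow> us"
proof -
  obtain r where r: "\<rho> \<longlonglongrightarrow> r" "0 < r" by (rule rho_limit)
  obtain h qq pp uu where h: "strict_mono (h::nat\<Rightarrow>nat)"
    and lim: "\<And>i. i < 4 \<Longrightarrow> (\<lambda>k. (q (Suc (h k + i)), p (Suc (h k + i)), u (Suc (h k + i)))) \<longlonglongrightarrow> (qq i, pp i, uu i)"
    by (rule convergent_window_iterates[OF kkt0 strict_mono_id, of 4]) (rule that, assumption, simp)
  have "\<forall>i<4. (\<lambda>k. (q (Suc (h k + i)), p (Suc (h k + i)), u (Suc (h k + i)))) \<longlonglongrightarrow> (qq i, pp i, uu i)"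
    using lim by blast
  note W = limit_window[OF kkt0 h this]
  have q: "(\<lambda>k. q (Suc (h k + j))) \<longlonglongrightarrow> qq j" and p: "(\<lambda>k. p (Suc (h k + j))) \<longlonglongrightarrow> pp j"
    and u: "(\<lambda>k. u (Suc (h k + j))) \<longlonglongrightarrow> uu j" if "j < 4" for j
    using tendsto_fst[OF lim[OF that]] tendsto_fst[OF tendsto_snd[OF lim[OF that]]]
      tendsto_snd[OF tendsto_snd[OF lim[OF that]]] by simp_all
  \<comment> \<open>\<open>q\<close> is taken one state later than \<open>p\<close> and
    \<open>u\<close>, matching the indices in \<open>res\<close> and in the
    \<open>q\<close>-step.\<close>
  define qs ps us where s: "qs = qq 2" "ps = pp 1" "us = uu 1"
  have "(\<lambda>k. A (p (Suc (h k + 1))) + B (q (Suc (h k + 2)))) \<longlonglongrightarrow> A ps + B qs"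
    unfolding s by (intro tendsto_intros tendsto_AB q p) auto
  moreover have "(\<lambda>k. A (p (Suc (h k + 1))) + B (q (Suc (h k + 2)))) \<longlonglongrightarrow> 0"
    using LIMSEQ_subseq_LIMSEQ[OF LIMSEQ_ignore_initial_segment[OF res, of 2] h] by (simp add: o_def res_def)
  ultimately have feas: "A ps + B qs = 0" by (rule LIMSEQ_unique)
  have kkt: "kkt qs ps us"
    unfolding kkt_def s
    using W(1)[of 1] W(2)[of 2] W(5)[of 0] W(6)[of 1] feas
    by (auto simp: s eval_nat_numeral)
  have qz: "qform (qq 1 - qs) (qq 1 - qs) = 0"
    using W(3)[of 1] bilinear_qform unfolding s
    by (simp add: eval_nat_numeral bilinear_lsub bilinear_rsub algebra_simps)
  have pz: "pform (pp 0 - ps) (pp 0 - ps) = 0"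
    using W(4)[of 0] bilinear_pform unfolding s
    by (simp add: bilinear_lsub bilinear_rsub algebra_simps)
  have "(\<lambda>k. lyap qs ps us (h k + 1)) \<longlonglongrightarrow>
    (norm (uu 1 + c *\<^sub>R A (pp 1) - (us + c *\<^sub>R A ps)))\<^sup>2 / (c * r) + qform (qq 1 - qs) (qq 1 - qs) + pform (pp 0 - ps) (pp 0 - ps)"
  proof (rule lyap_limit[OF r])
    show "strict_mono (\<lambda>k. h k + 1)" using h by (simp add: strict_mono_def)
  qed (use q[of 1] p[of 1] u[of 1] p[of 0] in simp_all)
  \<comment> \<open>The \<open>z\<close>-part vanishes exactly, the other two parts because
    \<open>qq 1 - qs\<close> and \<open>pp 0 - ps\<close> are null vectors.\<close>
  then have sub0: "(\<lambda>k. lyap qs ps us (h k + 1)) \<longlonglongrightarrow> 0" unfolding qz pz by (simp add: s)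
  obtain v where v: "lyap qs ps us \<longlonglongrightarrow> v"
    using decr_tendsto(2)[OF kkt] by (auto simp: convergent_def)
  have "(\<lambda>k. lyap qs ps us (h k + 1)) \<longlonglongrightarrow> v"
    using LIMSEQ_subseq_LIMSEQ[OF LIMSEQ_Suc[OF v] h] by (simp add: o_def)
  \<comment> \<open>\<open>lyap\<close> converges, so its limit along one subsequence is its
    limit.\<close>
  with sub0 v have V: "lyap qs ps us \<longlonglongrightarrow> 0" using LIMSEQ_unique by blast
  have V3: "(\<lambda>k. 3 * c * lyap qs ps us k) \<longlonglongrightarrow> 0"
    using tendsto_mult_right_zero[OF V, of "3 * c"] by simp
  have u_lim: "u \<longlonglongrightarrow> us"
  proof (rule tendsto_of_power2_norm_le[where d = 1, OF _ V3])
    show "1 * (norm (u (Suc k) - us))\<^sup>2 \<le> 3 * c * lyap qs ps us k" for k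
      using lyap_parts(4)[OF kkt, of k]
        mult_nonneg_nonneg[OF zero_le_power2[of c] zero_le_power2[of "norm (A (p (Suc k) - ps))"]] by linarith
  qed simp
  have p_lim: "p \<longlonglongrightarrow> ps"
  proof (rule tendsto_of_power2_norm_le[where d = m])
    show "m * (norm (p (Suc k) - ps))\<^sup>2 \<le> lyap qs ps us (Suc k) + 3 * lyap qs ps us k" for k
      by (rule lyap_parts(5)[OF kkt])
    show "(\<lambda>k. lyap qs ps us (Suc k) + 3 * lyap qs ps us k) \<longlonglongrightarrow> 0"
      using tendsto_add[OF LIMSEQ_Suc[OF V] tendsto_mult_right_zero[OF V, of 3]] by simp
  qed (rule m_pos)
  have q_lim: "q \<longlonglongrightarrow> qs"
  proof (rule tendsto_of_power2_norm_le[where d = n])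
    \<comment> \<open>\<open>lyap\<close> controls only the seminorm of
      \<open>q (Suc k) - qs\<close>; the missing part \<open>B (q (Suc k) - qs)\<close> is recovered
      from the residual and \<open>A (p k - ps)\<close>, which both tend to 0.\<close>
    define b where "b k = res k - A (p k - ps)" for k
    have b: "B (q (Suc k) - qs) = b k" for k
      using feas by (simp add: b_def res_def lin algebra_simps eq_neg_iff_add_eq_0)
    have "b \<longlonglongrightarrow> 0 - A (ps - ps)"
      unfolding b_def by (intro tendsto_intros tendsto_AB res p_lim)
    then have b0: "b \<longlonglongrightarrow> 0" by (simp add: lin)
    have "(\<lambda>k. lyap qs ps us k + c * (b k \<bullet> b k)) \<longlonglongrightarrow> 0 + c * (0 \<bullet> (0::'x))"
      by (rule tendsto_add[OF V tendsto_mult_left[OF tendsto_inner[OF b0 b0]]])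
    then show "(\<lambda>k. lyap qs ps us k + c * (b k \<bullet> b k)) \<longlonglongrightarrow> 0" by simp
    show "n * (norm (q (Suc k) - qs))\<^sup>2 \<le> lyap qs ps us k + c * (b k \<bullet> b k)" for k
      using lyap_parts(2)[OF kkt, of k] by (simp add: qform_def b power2_norm_eq_inner)
  qed (rule n_pos)
  show ?thesis using kkt q_lim p_lim u_lim by blast
qed

section \<open>The residual tends to zero\<close>

text \<open>The weights \<open>2 - \<rho> k\<close> in \<open>decr\<close> stay above the positive
  number \<open>2 - r\<close>.\<close>

lemma res_tendsto_0_underrelaxed:
  assumes kkt: "kkt q0 p0 u0" and r: "\<rho> \<longlonglongrightarrow> r" "r < 2"
  shows "res \<longlonglongrightarrow> 0"
proof -
  have le: "\<rho> k \<le> r" for k by (rule incseq_le[OF rho_mono r(1)])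
  have "(\<lambda>k. decr k / ((2 - r) * c)) \<longlonglongrightarrow> 0 / ((2 - r) * c)"
    by (intro tendsto_intros decr_tendsto(1)[OF kkt]) (use r c_pos in simp)
  then have *: "(\<lambda>k. decr k / ((2 - r) * c)) \<longlonglongrightarrow> 0" by simp
  have "(norm (res (Suc k)))\<^sup>2 \<le> decr k / ((2 - r) * c)" for k
  proof -
    have "(2 - r) * c * (norm (res (Suc k)))\<^sup>2 \<le> (2 - \<rho> (Suc k)) * c * (norm (res (Suc k)))\<^sup>2"
      using le[of "Suc k"] c_pos by (intro mult_right_mono) auto
    also have "\<dots> \<le> decr k"
      using pform_nonneg[of "p (Suc k) - p k"] qform_nonneg[of "q (Suc (Suc k)) - q (Suc k)"]
      unfolding decr_def by simp
    finally show ?thesis using r c_pos by (simp add: field_simps)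
  qed
  then have "(\<lambda>k. (norm (res (Suc k)))\<^sup>2) \<longlonglongrightarrow> 0"
    by (intro tendsto_sandwich[OF _ _ tendsto_const *]) auto
  then have "(\<lambda>k. res (Suc k)) \<longlonglongrightarrow> 0" by (rule power2_norm_tendsto_0_imp)
  then show ?thesis by (rule LIMSEQ_imp_Suc)
qed

text \<open>\<open>definite\<close> and \<open>rigid\<close> isolate what is asked of the concrete
  problem: the \<open>q\<close>-seminorm is a norm, and among four stationary states linked by the
  reflection the middle two share \<open>A p\<close>.\<close>

lemma res_tendsto_0_limit_2:
  assumes kkt: "kkt qs ps us" and r: "\<rho> \<longlonglongrightarrow> 2"
    and definite: "\<And>x. qform x x = 0 \<Longrightarrow> x = 0"
    and rigid: "\<And>(pp :: nat \<Rightarrow> 'p) (uu :: nat \<Rightarrow> 'x) b.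
      (\<And>i. i < 4 \<Longrightarrow> pp i \<in> P \<and> (\<forall>x\<in>P. l \<bullet> (x - pp i) + uu i \<bullet> A (x - pp i) \<le> 0)) \<Longrightarrow>
      (\<And>i. i < 3 \<Longrightarrow> pform (pp (Suc i) - pp i) (pp (Suc i) - pp i) = 0) \<Longrightarrow>
      (\<And>i. i < 3 \<Longrightarrow> uu (Suc i) + c *\<^sub>R (A (pp (Suc i)) + b) = uu i - c *\<^sub>R (A (pp i) + b)) \<Longrightarrow>
      A (pp 1) = A (pp 2)"
  shows "res \<longlonglongrightarrow> 0"
proof -
  \<comment> \<open>The offset 3 addresses the residual that pairs \<open>pp 2\<close> with
    \<open>qq 3\<close>, inside the window of six states.\<close>
  have "(\<lambda>k. res (k + 3)) \<longlonglongrightarrow> 0"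
  proof (rule tendsto_subseq_criterion)
    fix f :: "nat \<Rightarrow> nat" assume f: "strict_mono f"
    obtain g qq pp uu where g: "strict_mono (g::nat\<Rightarrow>nat)" and fg: "strict_mono (\<lambda>k. f (g k))"
      and lim0: "\<And>i. i < 6 \<Longrightarrow> (\<lambda>k. (q (Suc (f (g k) + i)), p (Suc (f (g k) + i)), u (Suc (f (g k) + i)))) \<longlonglongrightarrow> (qq i, pp i, uu i)"
      using convergent_window_iterates[OF kkt f, of 6] by blast
    define h where "h = (\<lambda>k. f (g k))"
    have h: "strict_mono h" using fg by (simp add: h_def)
    have lim: "(\<lambda>k. (q (Suc (h k + i)), p (Suc (h k + i)), u (Suc (h k + i)))) \<longlonglongrightarrow> (qq i, pp i, uu i)"
      if "i < 6" for i
      using lim0[OF that] by (simp add: h_def)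
    have "\<forall>i<6. (\<lambda>k. (q (Suc (h k + i)), p (Suc (h k + i)), u (Suc (h k + i)))) \<longlonglongrightarrow> (qq i, pp i, uu i)"
      using lim by blast
    note W = limit_window[OF kkt h this]
    have q: "(\<lambda>k. q (Suc (h k + j))) \<longlonglongrightarrow> qq j" and p: "(\<lambda>k. p (Suc (h k + j))) \<longlonglongrightarrow> pp j"
      and u: "(\<lambda>k. u (Suc (h k + j))) \<longlonglongrightarrow> uu j" if "j < 6" for j
      using tendsto_fst[OF lim[OF that]] tendsto_fst[OF tendsto_snd[OF lim[OF that]]]
        tendsto_snd[OF tendsto_snd[OF lim[OF that]]] by simp_all
    define q' b where "q' = qq 0" and "b = B q'"
    have qq: "qq i = q'" if "i < 6" for i
      using that
    proof (induction i)
      case (Suc i)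
      then show ?case using definite[OF W(3)[of i]] by simp
    qed (simp add: q'_def)
    have step: "uu (Suc i) + c *\<^sub>R (A (pp (Suc i)) + b) = uu i - c *\<^sub>R (A (pp i) + b)" if "i < 5" for i
      using W(7)[of i 2] r that qq[of "Suc i"]
      by (simp add: b_def scaleR_2 algebra_simps)
    \<comment> \<open>Stationarity in \<open>p\<close> is known from the second state of the window
      on, hence the shift by one.\<close>
    have "A (pp (Suc 1)) = A (pp (Suc 2))"
      by (rule rigid[of "\<lambda>i. pp (Suc i)" "\<lambda>i. uu (Suc i)" b]) (use W(1,4,5) step in auto)
    then have App: "A (pp 3) = A (pp 2)" by (simp add: eval_nat_numeral)
    \<comment> \<open>\<open>y i\<close> is the limit of \<open>z\<close> relative to the KKT
      point.\<close>
    define y where "y i = uu i + c *\<^sub>R A (pp i) - (us + c *\<^sub>R A ps)" for i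
    define w where "w = (2 * c) *\<^sub>R (A (pp 2) + b)"
    have y_step: "y (Suc i) = y i - (2 * c) *\<^sub>R (A (pp i) + b)" if "i < 5" for i
      using step[OF that] unfolding y_def mult_2 scaleR_add_left by (simp add: algebra_simps)
    have y3: "y 3 = y 2 - w" and y4: "y 4 = y 3 - w"
      using y_step[of 2] y_step[of 3] App by (simp_all add: w_def eval_nat_numeral)
    obtain v where v: "lyap qs ps us \<longlonglongrightarrow> v"
      using decr_tendsto(2)[OF kkt] by (auto simp: convergent_def)
    \<comment> \<open>Null increments leave the seminorm of \<open>pp i - ps\<close> unchanged, so
      along the window the limit of \<open>lyap\<close> depends on the state only through
      \<open>norm (y (Suc i))\<close>.\<close>
    have pf: "pform (pp i - ps) (pp i - ps) = pform (pp 0 - ps) (pp 0 - ps)" if "i < 5" for i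
      using that
    proof (induction i)
      case (Suc i)
      then show ?case using pform_shift[OF W(4)[of i], of "pp i - ps"] by simp
    qed simp
    have five: "1 < (5::nat)" "2 < (5::nat)" "3 < (5::nat)" by simp_all
    have "(norm (y (Suc i)))\<^sup>2 / (c * 2) + qform (q' - qs) (q' - qs) + pform (pp 0 - ps) (pp 0 - ps) = v"
      if "i < 5" for i
    proof (rule LIMSEQ_unique)
      have "(\<lambda>k. lyap qs ps us (h k + Suc i)) \<longlonglongrightarrow>
        (norm (uu (Suc i) + c *\<^sub>R A (pp (Suc i)) - (us + c *\<^sub>R A ps)))\<^sup>2 / (c * 2) + qform (qq (Suc i) - qs) (qq (Suc i) - qs)
         + pform (pp i - ps) (pp i - ps)"
      proof (rule lyap_limit[OF r])
        show "strict_mono (\<lambda>k. h k + Suc i)" using h by (simp add: strict_mono_def)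
      qed (use q[of "Suc i"] p[of "Suc i"] u[of "Suc i"] p[of i] that in simp_all)
      then show "(\<lambda>k. lyap qs ps us (h k + Suc i)) \<longlonglongrightarrow>
        (norm (y (Suc i)))\<^sup>2 / (c * 2) + qform (q' - qs) (q' - qs) + pform (pp 0 - ps) (pp 0 - ps)"
        using that pf[of i] by (simp add: y_def qq)
      show "(\<lambda>k. lyap qs ps us (h k + Suc i)) \<longlonglongrightarrow> v"
        using LIMSEQ_subseq_LIMSEQ[OF LIMSEQ_ignore_initial_segment[OF v, of "Suc i"] h] by (simp add: o_def)
    qed
    from this[of 1, OF five(1)] this[of 2, OF five(2)] this[of 3, OF five(3)]
    have "(norm (y 2))\<^sup>2 / (c * 2) = (norm (y 3))\<^sup>2 / (c * 2)" "(norm (y 3))\<^sup>2 / (c * 2) = (norm (y 4))\<^sup>2 / (c * 2)"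
      unfolding Suc_1 Suc_numeral semiring_norm by linarith+
    then have "(norm (y 2))\<^sup>2 = (norm (y 3))\<^sup>2" "(norm (y 3))\<^sup>2 = (norm (y 4))\<^sup>2"
      using c_pos by simp_all
    \<comment> \<open>\<open>y 2\<close>, \<open>y 3\<close>, \<open>y 4\<close> are equally spaced
      on a line and equally far from the origin, hence equal: the second difference of their squared
      norms is \<open>2 * (w \<bullet> w)\<close>.\<close>
    moreover have "(norm (y 3))\<^sup>2 = (norm (y 2))\<^sup>2 - 2 * (y 2 \<bullet> w) + w \<bullet> w"
      "(norm (y 4))\<^sup>2 = (norm (y 2))\<^sup>2 - 4 * (y 2 \<bullet> w) + 4 * (w \<bullet> w)"
      unfolding y4 y3 power2_norm_eq_inner
      by (simp_all add: inner_diff_left inner_diff_right inner_commute[of w "y 2"])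
    ultimately have "w \<bullet> w = 0" by linarith
    then have "A (pp 2) + b = 0" using c_pos by (simp add: w_def)
    moreover have "(\<lambda>k. A (p (Suc (h k + 2))) + B (q (Suc (h k + 3)))) \<longlonglongrightarrow> A (pp 2) + B (qq 3)"
      by (intro tendsto_intros tendsto_AB p q) auto
    moreover have "qq 3 = q'" by (rule qq) simp
    ultimately have "(\<lambda>k. res (f (g k) + 3)) \<longlonglongrightarrow> 0"
      by (simp add: res_def b_def h_def eval_nat_numeral)
    then show "\<exists>g. strict_mono (g::nat\<Rightarrow>nat) \<and> (\<lambda>k. res (f (g k) + 3)) \<longlonglongrightarrow> 0" using g by blast
  qed
  then show ?thesis by (rule LIMSEQ_offset)
qed

end

section \<open>The discrete gradient and the pixel problem\<close>

lemma forward_diff_bound: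
  fixes f :: "'a::{finite,linorder} \<Rightarrow> real"
  shows "(\<Sum>i\<in>UNIV. (forward_diff f i)\<^sup>2) \<le> 4 * (\<Sum>i\<in>UNIV. (f i)\<^sup>2)" (is ?le)
    and "(\<Sum>i\<in>UNIV. (forward_diff f i)\<^sup>2) = 4 * (\<Sum>i\<in>UNIV. (f i)\<^sup>2) \<Longrightarrow> f i = 0"
proof -
  define S where "S = {i::'a. \<exists>j. i < j}"
  define nxt where "nxt = (\<lambda>i::'a. Min {j. i < j})"
  have nxt_gt: "i < nxt i" if "i \<in> S" for i
    using Min_in[of "{j. i < j}"] that unfolding S_def nxt_def by auto
  have nxt_le: "nxt i \<le> j" if "i < j" for i j
    unfolding nxt_def using that by (intro Min_le) auto
  have inj: "inj_on nxt S"
  proof (rule linorder_inj_onI)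
    fix i j assume "i < j" "i \<in> S" "j \<in> S"
    then show "nxt i \<noteq> nxt j" using nxt_gt[of j] nxt_le[of i j] by force
  qed auto
  have split: "(\<Sum>i\<in>UNIV. g i) = (\<Sum>i\<in>T. g i) + (\<Sum>i\<in>-T. g i)" for g :: "'a \<Rightarrow> real" and T
    using sum.subset_diff[of T UNIV g] by (simp add: Compl_eq_Diff_UNIV add.commute)
  \<comment> \<open>\<open>(a - b)\<^sup>2 = 2 a\<^sup>2 + 2 b\<^sup>2 - (a + b)\<^sup>2\<close>, and every index is counted at most twice. Equality
    forces \<open>f\<close> to alternate in sign and to vanish at the last index.\<close>
  have "(\<Sum>i\<in>UNIV. (forward_diff f i)\<^sup>2) = (\<Sum>i\<in>S. (f (nxt i) - f i)\<^sup>2)"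
    unfolding split[of _ S] by (simp add: forward_diff_def S_def nxt_def)
  also have "\<dots> = (\<Sum>i\<in>S. 2 * (f (nxt i))\<^sup>2 + 2 * (f i)\<^sup>2 - (f (nxt i) + f i)\<^sup>2)"
    by (rule sum.cong) (simp_all add: power2_eq_square algebra_simps)
  also have "\<dots> = 2 * (\<Sum>i\<in>nxt ` S. (f i)\<^sup>2) + 2 * (\<Sum>i\<in>S. (f i)\<^sup>2) - (\<Sum>i\<in>S. (f (nxt i) + f i)\<^sup>2)"
    by (simp add: sum.reindex[OF inj] sum.distrib sum_subtractf sum_distrib_left)
  finally have eq: "4 * (\<Sum>i\<in>UNIV. (f i)\<^sup>2) - (\<Sum>i\<in>UNIV. (forward_diff f i)\<^sup>2)
      = 2 * (\<Sum>i\<in>-nxt ` S. (f i)\<^sup>2) + 2 * (\<Sum>i\<in>-S. (f i)\<^sup>2) + (\<Sum>i\<in>S. (f (nxt i) + f i)\<^sup>2)"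
    using split[of "\<lambda>i. (f i)\<^sup>2" S] split[of "\<lambda>i. (f i)\<^sup>2" "nxt ` S"] by linarith
  have nonneg: "0 \<le> (\<Sum>i\<in>-nxt ` S. (f i)\<^sup>2)" "0 \<le> (\<Sum>i\<in>-S. (f i)\<^sup>2)" "0 \<le> (\<Sum>i\<in>S. (f (nxt i) + f i)\<^sup>2)"
    by (simp_all add: sum_nonneg)
  then show ?le using eq by linarith
  assume "(\<Sum>i\<in>UNIV. (forward_diff f i)\<^sup>2) = 4 * (\<Sum>i\<in>UNIV. (f i)\<^sup>2)"
  then have "(\<Sum>i\<in>-S. (f i)\<^sup>2) = 0" "(\<Sum>i\<in>S. (f (nxt i) + f i)\<^sup>2) = 0"
    using eq nonneg by linarith+
  then have last: "\<And>i. i \<notin> S \<Longrightarrow> f i = 0" and alt: "\<And>i. i \<in> S \<Longrightarrow> f i = - f (nxt i)"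
    by (auto simp: sum_nonneg_eq_0_iff eq_neg_iff_add_eq_0 add.commute)
  show "f i = 0"
  proof (rule ccontr)
    assume "f i \<noteq> 0"
    \<comment> \<open>\<open>M\<close> is the last index of the support; alternation of signs would
      carry the support one index further.\<close>
    define M where "M = Max {i. f i \<noteq> 0}"
    have "M \<in> {i. f i \<noteq> 0}" unfolding M_def using \<open>f i \<noteq> 0\<close> by (intro Max_in) auto
    then have M: "f M \<noteq> 0" by simp
    then have "M \<in> S" using last by blast
    then have "f (nxt M) \<noteq> 0" "M < nxt M" using M alt nxt_gt by auto
    moreover have "nxt M \<le> M" unfolding M_def by (rule Max_ge) (use calculation M_def in auto)
    ultimately show False by simp
  qed
qed

lemma forward_diff_add: "forward_diff (\<lambda>i. f i + g i) j = forward_diff f j + forward_diff g j"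
  and forward_diff_cmult: "forward_diff (\<lambda>i. a * f i) j = a * forward_diff f j"
  by (simp_all add: forward_diff_def algebra_simps)

lemma linear_grad: "linear grad"
  by (rule linearI)
     (simp_all add: grad_def vec_eq_iff forall_2 forward_diff_add forward_diff_cmult)

lemma norm_grad:
  "(norm (grad u))\<^sup>2 = (\<Sum>j\<in>UNIV. \<Sum>i\<in>UNIV. (forward_diff (\<lambda>i. u $ (i, j)) i)\<^sup>2)
     + (\<Sum>i\<in>UNIV. \<Sum>j\<in>UNIV. (forward_diff (\<lambda>j. u $ (i, j)) j)\<^sup>2)"
proof -
  have "(norm (grad u))\<^sup>2 = (\<Sum>(i, j)\<in>UNIV \<times> UNIV. (forward_diff (\<lambda>i. u $ (i, j)) i)\<^sup>2 + (forward_diff (\<lambda>j. u $ (i, j)) j)\<^sup>2)"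
    unfolding power2_norm_eq_inner UNIV_Times_UNIV
    by (simp add: inner_vec_def sum_2 grad_def power2_eq_square case_prod_unfold)
  also have "\<dots> = (\<Sum>i\<in>UNIV. \<Sum>j\<in>UNIV. (forward_diff (\<lambda>i. u $ (i, j)) i)\<^sup>2) + (\<Sum>i\<in>UNIV. \<Sum>j\<in>UNIV. (forward_diff (\<lambda>j. u $ (i, j)) j)\<^sup>2)"
    unfolding sum.cartesian_product[symmetric] by (simp add: sum.distrib)
  finally show ?thesis by (subst (asm) sum.swap)
qed

lemma norm_img:
  fixes u :: "('m::finite, 'n::finite) img"
  shows "(norm u)\<^sup>2 = (\<Sum>i\<in>UNIV. \<Sum>j\<in>UNIV. (u $ (i, j))\<^sup>2)"
  unfolding power2_norm_eq_inner
  by (simp add: inner_vec_def sum.cartesian_product power2_eq_square case_prod_unfold flip: UNIV_Times_UNIV)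

text \<open>Columns and rows contribute a factor 4 each. Equality in the sum forces equality in
  every column, where the one-dimensional bound admits it only for the zero column.\<close>

lemma grad_bound:
  fixes u :: "('m::{finite,linorder}, 'n::{finite,linorder}) img"
  shows "(norm (grad u))\<^sup>2 \<le> 8 * (norm u)\<^sup>2"
    and "(norm (grad u))\<^sup>2 = 8 * (norm u)\<^sup>2 \<Longrightarrow> u = 0"
proof -
  let ?c = "\<lambda>j. \<Sum>i\<in>UNIV. (u $ (i, j))\<^sup>2" and ?dc = "\<lambda>j. \<Sum>i\<in>UNIV. (forward_diff (\<lambda>i. u $ (i, j)) i)\<^sup>2"
  let ?r = "\<lambda>i. \<Sum>j\<in>UNIV. (u $ (i, j))\<^sup>2" and ?dr = "\<lambda>i. \<Sum>j\<in>UNIV. (forward_diff (\<lambda>j. u $ (i, j)) j)\<^sup>2"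
  have r: "(norm u)\<^sup>2 = (\<Sum>i\<in>UNIV. ?r i)" by (rule norm_img)
  then have c: "(norm u)\<^sup>2 = (\<Sum>j\<in>UNIV. ?c j)" by (subst (asm) sum.swap)
  have lec: "?dc j \<le> 4 * ?c j" for j by (rule forward_diff_bound)
  have ler: "?dr i \<le> 4 * ?r i" for i by (rule forward_diff_bound)
  have sumc: "(\<Sum>j\<in>UNIV. ?dc j) \<le> 4 * (norm u)\<^sup>2" unfolding c by (subst sum_distrib_left, rule sum_mono, rule lec)
  have sumr: "(\<Sum>i\<in>UNIV. ?dr i) \<le> 4 * (norm u)\<^sup>2" unfolding r by (subst sum_distrib_left, rule sum_mono, rule ler)
  show "(norm (grad u))\<^sup>2 \<le> 8 * (norm u)\<^sup>2" unfolding norm_grad using sumc sumr by linarith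
  assume "(norm (grad u))\<^sup>2 = 8 * (norm u)\<^sup>2"
  then have "(\<Sum>j\<in>UNIV. ?dc j) = 4 * (norm u)\<^sup>2" using sumc sumr unfolding norm_grad by linarith
  then have "(\<Sum>j\<in>UNIV. 4 * ?c j - ?dc j) = 0" unfolding c by (simp add: sum_subtractf sum_distrib_left)
  then have "\<forall>j. 4 * ?c j - ?dc j = 0" using lec by (subst (asm) sum_nonneg_eq_0_iff) auto
  then have "u $ (i, j) = 0" for i j
    using forward_diff_bound(2)[of "\<lambda>i. u $ (i, j)" i] by simp
  then show "u = 0" by (simp add: vec_eq_iff)
qed

lemma linear_dvg: "linear dvg"
  unfolding dvg_def by (rule linear_compose_neg) (rule adjoint_linear[OF linear_grad])

lemma inner_dvg: "dvg q \<bullet> u = - (q \<bullet> grad u)"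
  using adjoint_works[OF linear_grad, of u q] by (simp add: dvg_def inner_commute)

text \<open>By duality \<open>dvg q \<bullet> dvg q\<close> is
  \<open>- (q \<bullet> grad (dvg q))\<close>, so Cauchy-Schwarz and \<open>grad_bound\<close> carry
  the constant over to the adjoint. Equality for \<open>q\<close> forces equality in
  \<open>grad_bound\<close> for \<open>dvg q\<close>.\<close>

lemma dvg_bound:
  fixes q :: "('m::{finite,linorder}, 'n::{finite,linorder}) vfield"
  shows "dvg q \<bullet> dvg q \<le> 8 * (q \<bullet> q)"
    and "dvg q \<bullet> dvg q = 8 * (q \<bullet> q) \<Longrightarrow> q = 0"
proof -
  let ?b = "dvg q"
  have "(norm ?b)\<^sup>2 = - (q \<bullet> grad ?b)" unfolding power2_norm_eq_inner by (rule inner_dvg)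
  also have "\<dots> \<le> norm q * norm (grad ?b)" using Cauchy_Schwarz_ineq2[of q "grad ?b"] by linarith
  finally have "((norm ?b)\<^sup>2)\<^sup>2 \<le> (norm q * norm (grad ?b))\<^sup>2" by (rule power_mono) simp
  then have 1: "(norm ?b)\<^sup>2 * (norm ?b)\<^sup>2 \<le> (norm q)\<^sup>2 * (norm (grad ?b))\<^sup>2"
    by (simp add: power_mult_distrib flip: power2_eq_square)
  also have 2: "\<dots> \<le> (norm q)\<^sup>2 * (8 * (norm ?b)\<^sup>2)"
    by (rule mult_left_mono[OF grad_bound(1)]) simp
  finally have 3: "(norm ?b)\<^sup>2 * (norm ?b)\<^sup>2 \<le> (8 * (norm q)\<^sup>2) * (norm ?b)\<^sup>2" by (simp add: algebra_simps)
  have "(norm ?b)\<^sup>2 \<le> 8 * (norm q)\<^sup>2"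
  proof (cases "?b = 0")
    case False
    then have "0 < (norm ?b)\<^sup>2" by simp
    with 3 show ?thesis by (rule mult_right_le_imp_le)
  qed simp
  then show "?b \<bullet> ?b \<le> 8 * (q \<bullet> q)" by (simp add: power2_norm_eq_inner)
  assume "?b \<bullet> ?b = 8 * (q \<bullet> q)"
  then have eq: "(norm ?b)\<^sup>2 = 8 * (norm q)\<^sup>2" by (simp add: power2_norm_eq_inner)
  show "q = 0"
  proof (rule ccontr)
    assume q: "q \<noteq> 0"
    then have "0 < (norm q)\<^sup>2" by simp
    moreover have "(norm q)\<^sup>2 * (8 * (norm ?b)\<^sup>2) \<le> (norm q)\<^sup>2 * (norm (grad ?b))\<^sup>2"
    proof -
      have "(norm q)\<^sup>2 * (8 * (norm ?b)\<^sup>2) = (8 * (norm q)\<^sup>2) * (norm ?b)\<^sup>2" by simp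
      also have "\<dots> = (norm ?b)\<^sup>2 * (norm ?b)\<^sup>2" by (simp only: eq)
      finally show ?thesis using 1 by linarith
    qed
    ultimately have "8 * (norm ?b)\<^sup>2 \<le> (norm (grad ?b))\<^sup>2" by (rule mult_left_le_imp_le[rotated])
    then have "?b = 0" using grad_bound[of ?b] by (simp add: order_antisym)
    then show False using eq q by simp
  qed
qed

lemma linear_A_op: "linear A_op"
  by (rule linearI) (simp_all add: A_op_def algebra_simps)

text \<open>Exhibits the form of 2I - A*A as a square: its null increments are those that keep the
  sum of the two components of \<open>p\<close> fixed.\<close>

lemma A_op_parallelogram: "2 * (p \<bullet> p) - A_op p \<bullet> A_op p = (norm (fst p + snd p))\<^sup>2"
  unfolding power2_norm_eq_inner
  by (cases p) (simp add: A_op_def inner_diff_left inner_diff_right inner_add_left inner_add_right inner_commute)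

lemma A_op_bound: "A_op p \<bullet> A_op p \<le> 2 * (p \<bullet> p)"
  using A_op_parallelogram[of p] zero_le_power2[of "norm (fst p + snd p)"] by linarith

lemma op_ge_adjoint:
  fixes f :: "'a::euclidean_space \<Rightarrow> 'b::euclidean_space"
  assumes f: "linear f" and le: "\<And>x. f x \<bullet> f x \<le> a * (x \<bullet> x)" and "0 \<le> c"
  shows "op_ge (\<lambda>x. a *\<^sub>R x) (\<lambda>x. adjoint f (f x))"
    and "op_ge (\<lambda>x. (a * c) *\<^sub>R x - c *\<^sub>R adjoint f (f x)) (\<lambda>x. 0)"
proof -
  have L: "linear (\<lambda>x. adjoint f (f x))"
    using linear_compose[OF f adjoint_linear[OF f]] by (simp add: o_def)
  have adj: "adjoint f y \<bullet> x = y \<bullet> f x" "x \<bullet> adjoint f y = f x \<bullet> y" for x y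
    using adjoint_works[OF f, of x y] by (simp_all add: inner_commute)
  have id: "linear (\<lambda>x::'a. b *\<^sub>R x)" for b by (intro linearI) (simp_all add: algebra_simps)
  have lin: "linear (\<lambda>x. (a * c) *\<^sub>R x - c *\<^sub>R adjoint f (f x))"
    by (intro linear_compose_sub id linear_compose_scale_right L)
  show "op_ge (\<lambda>x. a *\<^sub>R x) (\<lambda>x. adjoint f (f x))"
    unfolding op_ge_def selfadjoint_def
    using L id le by (auto simp: adj inner_diff_right)
  have "c * (f x \<bullet> f x) \<le> c * (a * (x \<bullet> x))" for x using le assms(3) by (rule mult_left_mono)
  then show "op_ge (\<lambda>x. (a * c) *\<^sub>R x - c *\<^sub>R adjoint f (f x)) (\<lambda>x. 0)"
    unfolding op_ge_def selfadjoint_def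
    using lin linear_zero by (auto simp: adj inner_diff_right inner_diff_left algebra_simps)
qed

section \<open>From the resolvent iteration to variational inequalities\<close>

lemma relaxed_admm_of_generates_iterates:
  fixes A :: "'p::euclidean_space \<Rightarrow> 'x::euclidean_space" and B :: "'q::euclidean_space \<Rightarrow> 'x"
  assumes lin: "linear A" "linear B"
    and pos: "c > 0" "m > 0" "n > 0"
    and ge: "\<And>x. c * (A x \<bullet> A x) \<le> m * (x \<bullet> x)" "\<And>x. c * (B x \<bullet> B x) \<le> n * (x \<bullet> x)"
    and rho: "mono \<rho>" "\<And>k. 0 < \<rho> k" "\<And>k. \<rho> k < 2"
    and P: "closed P" "convex P" "P \<noteq> {}" and Q: "closed Q" "convex Q" "Q \<noteq> {}" "bounded Q"
    and gen: "generates_iterates A B (\<lambda>x. ereal (- (l \<bullet> x)) + ind_fun P x) (ind_fun Q) c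
      (\<lambda>q. n *\<^sub>R q) (\<lambda>p. m *\<^sub>R p) \<rho> q p u"
  shows "relaxed_admm A B l P Q c m n \<rho> q p u"
proof -
  \<comment> \<open>The \<open>q\<close>-resolvent is the case \<open>l = 0\<close> of the general
    resolvent lemma.\<close>
  have H: "(\<lambda>x. ereal (- ((0::'q) \<bullet> x)) + ind_fun Q x) = ind_fun Q" by (simp add: fun_eq_iff)
  have adj: "adjoint A y \<bullet> x = y \<bullet> A x" "adjoint B y \<bullet> v = y \<bullet> B v" for x y v
    using adjoint_works[OF lin(1), of x y] adjoint_works[OF lin(2), of v y] by (simp_all add: inner_commute)
  note resQ = resolvent_linear_plus_ind[OF Q(1-3) pos(3), where l = 0, unfolded H]
  note resP = resolvent_linear_plus_ind[OF P pos(2), where l = l]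
  have qs: "q (Suc k) = resolvent (\<lambda>q. n *\<^sub>R q) (ind_fun Q)
            (adjoint B (- c *\<^sub>R A (p k) + u k) + (n *\<^sub>R q k - c *\<^sub>R adjoint B (B (q k))))"
    and ps: "p (Suc k) = resolvent (\<lambda>p. m *\<^sub>R p) (\<lambda>x. ereal (- (l \<bullet> x)) + ind_fun P x)
            (adjoint A (- (c * \<rho> k) *\<^sub>R B (q (Suc k)) + (c * (1 - \<rho> k)) *\<^sub>R A (p k) + u k)
             + (m *\<^sub>R p k - c *\<^sub>R adjoint A (A (p k))))"
    and us: "u (Suc k) = u k - c *\<^sub>R (A (p (Suc k)) - (1 - \<rho> k) *\<^sub>R A (p k) + \<rho> k *\<^sub>R B (q (Suc k)))" for k
    using gen unfolding generates_iterates_def by blast+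
  show ?thesis
  proof (intro relaxed_admm.intro constrained_problem.intro relaxed_admm_axioms.intro)
    show "q (Suc k) \<in> Q" for k unfolding qs[of k] by (rule resQ(1))
    show "p (Suc k) \<in> P" for k unfolding ps[of k] by (rule resP(1))
    show "(u k - c *\<^sub>R (A (p k) + B (q (Suc k)))) \<bullet> B (x - q (Suc k))
       \<le> n * ((q (Suc k) - q k) \<bullet> (x - q (Suc k))) - c * (B (q (Suc k) - q k) \<bullet> B (x - q (Suc k)))"
      if "x \<in> Q" for k x
    proof -
      define w where "w = x - q (Suc k)"
      show ?thesis
        using resQ(2)[OF that, where z = "adjoint B (- c *\<^sub>R A (p k) + u k) + (n *\<^sub>R q k - c *\<^sub>R adjoint B (B (q k)))"]
        unfolding qs[of k, symmetric] w_def[symmetric]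
        by (simp add: inner_add_left inner_diff_left adj linear_diff[OF lin(2)] algebra_simps)
    qed
    show "l \<bullet> (x - p (Suc k)) + u (Suc k) \<bullet> A (x - p (Suc k))
       \<le> m * ((p (Suc k) - p k) \<bullet> (x - p (Suc k))) - c * (A (p (Suc k) - p k) \<bullet> A (x - p (Suc k)))"
      if "x \<in> P" for k x
    proof -
      define w where "w = x - p (Suc k)"
      \<comment> \<open>Expanding \<open>u (Suc k)\<close> by its update turns the claim into the
        resolvent inequality.\<close>
      show ?thesis
        using resP(2)[OF that, where z = "adjoint A (- (c * \<rho> k) *\<^sub>R B (q (Suc k)) + (c * (1 - \<rho> k)) *\<^sub>R A (p k) + u k)
             + (m *\<^sub>R p k - c *\<^sub>R adjoint A (A (p k)))"]
        unfolding ps[of k, symmetric] w_def[symmetric] us[of k]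
        by (simp add: inner_add_left inner_diff_left adj linear_diff[OF lin(1)] algebra_simps)
    qed
  qed (use assms us in simp_all)
qed

section \<open>The constraint sets, an optimum and its multiplier\<close>

definition P_set :: "('m::finite, 'n::finite) img \<Rightarrow> ('m, 'n) img \<Rightarrow> (('m, 'n) img \<times> ('m, 'n) img) set" where
  "P_set C\<^sub>s C\<^sub>t = {p. (\<forall>x. fst p $ x \<le> C\<^sub>s $ x) \<and> (\<forall>x. snd p $ x \<le> C\<^sub>t $ x)}"

definition Q_set :: "real \<Rightarrow> ('m::finite, 'n::finite) vfield set" where
  "Q_set \<alpha> = {q. \<forall>x. norm (q $ x) \<le> \<alpha>}"

lemma G_fun_eq: "G_fun C\<^sub>s C\<^sub>t = (\<lambda>p. ereal (- ((1, 0) \<bullet> p)) + ind_fun (P_set C\<^sub>s C\<^sub>t) p)"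
  by (auto simp: fun_eq_iff G_fun_def ind_fun_def P_set_def inner_prod_def)

lemma H_fun_eq: "H_fun \<alpha> = ind_fun (Q_set \<alpha>)"
  by (simp add: H_fun_def sup_norm_def Q_set_def)

lemma closed_P_set: "closed (P_set C\<^sub>s C\<^sub>t)"
  unfolding P_set_def
  by (intro closed_Collect_conj closed_Collect_all closed_Collect_le continuous_intros)

lemma convex_P_set: "convex (P_set C\<^sub>s C\<^sub>t)"
  unfolding P_set_def convex_def by (auto intro!: convex_bound_le)

lemma Q_set_eq: "Q_set \<alpha> = (\<Inter>x. (\<lambda>q. q $ x) -` cball 0 \<alpha>)"
  unfolding Q_set_def by force

lemma closed_Q_set: "closed (Q_set \<alpha>)"
  unfolding Q_set_eq by (intro closed_INT ballI closed_vimage closed_cball continuous_intros)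

lemma convex_Q_set: "convex (Q_set \<alpha>)"
  unfolding Q_set_eq
  by (intro convex_INT convex_linear_vimage convex_cball linearI) simp_all

lemma bounded_Q_set: "bounded (Q_set \<alpha> :: ('m::finite, 'n::finite) vfield set)"
proof (rule boundedI)
  fix q :: "('m, 'n) vfield" assume "q \<in> Q_set \<alpha>"
  then have "(\<Sum>x\<in>UNIV. norm (q $ x)) \<le> (\<Sum>x\<in>(UNIV :: ('m \<times> 'n) set). \<alpha>)"
    unfolding Q_set_def by (intro sum_mono) blast
  then show "norm q \<le> (\<Sum>x\<in>(UNIV :: ('m \<times> 'n) set). \<alpha>)"
    using L2_set_le_sum[of UNIV "\<lambda>x. norm (q $ x)"]
    unfolding norm_vec_def[of q] by (rule order_trans[rotated]) simp
qed

text \<open>One of several nonnegative gaps is at most their sum; this turns bounds on the objective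
  into pixelwise bounds.\<close>

lemma inner_one_diff_ge:
  fixes a b :: "real^'a"
  assumes "\<And>x. a $ x \<le> b $ x"
  shows "b $ x - a $ x \<le> 1 \<bullet> b - 1 \<bullet> a"
proof -
  have "b $ x - a $ x \<le> (\<Sum>y\<in>UNIV. b $ y - a $ y)"
    by (rule member_le_sum) (use assms in auto)
  then show ?thesis by (simp add: inner_vec_def sum_subtractf)
qed

lemma optimum_exists:
  fixes C\<^sub>s C\<^sub>t :: "('m::{finite,linorder}, 'n::{finite,linorder}) img"
  assumes "\<alpha> > 0"
  shows "\<exists>p\<in>P_set C\<^sub>s C\<^sub>t. \<exists>q\<in>Q_set \<alpha>. A_op p + dvg q = 0 \<and>
    (\<forall>x\<in>P_set C\<^sub>s C\<^sub>t. \<forall>y\<in>Q_set \<alpha>. A_op x + dvg y = 0 \<longrightarrow> (1, 0) \<bullet> x \<le> (1, 0) \<bullet> p)"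
proof -
  \<comment> \<open>The lower bound \<open>L\<close> cuts off only points that are worse than the feasible point \<open>(p0, p0)\<close>, so
    eliminating \<open>p\<^sub>t\<close> by the constraint leaves a compact set.\<close>
  define p0 :: "('m, 'n) img" where "p0 = (\<chi> x. min (C\<^sub>s $ x) (C\<^sub>t $ x))"
  define L :: "('m, 'n) img" where "L = (\<chi> x. 1 \<bullet> p0 - 1 \<bullet> C\<^sub>s + C\<^sub>s $ x)"
  define K where "K = (cbox L C\<^sub>s \<times> Q_set \<alpha>) \<inter> {z. \<forall>x. (fst z + dvg (snd z)) $ x \<le> C\<^sub>t $ x}"
  have "continuous_on UNIV (dvg :: ('m, 'n) vfield \<Rightarrow> ('m, 'n) img)"
    using linear_dvg by (rule linear_continuous_on[OF linear_conv_bounded_linear[THEN iffD1]])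
  then have dvg_cont: "continuous_on UNIV (\<lambda>z::('m, 'n) img \<times> ('m, 'n) vfield. dvg (snd z))"
    by (rule continuous_on_compose2) (auto intro: continuous_intros)
  have "compact K"
    unfolding K_def
    by (intro compact_Int_closed compact_Times compact_cbox closed_Collect_all closed_Collect_le
        continuous_intros dvg_cont)
      (simp add: compact_eq_bounded_closed closed_Q_set bounded_Q_set)
  have p0_le: "p0 $ x \<le> C\<^sub>s $ x" "p0 $ x \<le> C\<^sub>t $ x" for x by (simp_all add: p0_def)
  have p0_K: "(p0, 0) \<in> K"
    using p0_le assms inner_one_diff_ge[of p0 C\<^sub>s]
    by (auto simp: K_def mem_box_cart L_def Q_set_def linear_0[OF linear_dvg] algebra_simps)
  have "continuous_on K (\<lambda>z. 1 \<bullet> fst z)" by (intro continuous_intros)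
  then obtain z where z: "z \<in> K" "\<And>y. y \<in> K \<Longrightarrow> 1 \<bullet> fst y \<le> 1 \<bullet> fst z"
    using continuous_attains_sup[OF \<open>compact K\<close>, of "\<lambda>z. 1 \<bullet> fst z"] p0_K by blast
  show ?thesis
  proof (intro bexI conjI ballI impI)
    \<comment> \<open>The second component is forced by the constraint.\<close>
    let ?p = "(fst z, fst z + dvg (snd z))"
    show "?p \<in> P_set C\<^sub>s C\<^sub>t" "snd z \<in> Q_set \<alpha>" using z(1) by (auto simp: K_def P_set_def mem_box_cart)
    show "A_op ?p + dvg (snd z) = 0" by (simp add: A_op_def)
    fix x y assume x: "x \<in> P_set C\<^sub>s C\<^sub>t" and y: "y \<in> Q_set \<alpha>" and feas: "A_op x + dvg y = 0"
    have snd: "snd x = fst x + dvg y" using feas by (simp add: A_op_def algebra_simps)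
    have "1 \<bullet> fst x \<le> 1 \<bullet> fst z"
    proof (cases "\<forall>i. L $ i \<le> fst x $ i")
      case True
      then have "(fst x, y) \<in> K" using x y snd by (auto simp: K_def P_set_def mem_box_cart)
      then show ?thesis using z(2) by fastforce
    next
      case False
      then obtain i where "fst x $ i < L $ i" by (auto simp: not_le)
      moreover have "C\<^sub>s $ i - fst x $ i \<le> 1 \<bullet> C\<^sub>s - 1 \<bullet> fst x"
        by (rule inner_one_diff_ge) (use x[unfolded P_set_def] in blast)
      ultimately have "1 \<bullet> fst x \<le> 1 \<bullet> p0" by (simp add: L_def)
      also have "\<dots> \<le> 1 \<bullet> fst z" using z(2)[OF p0_K] by simp
      finally show ?thesis .
    qed
    then show "(1, 0) \<bullet> x \<le> (1, 0) \<bullet> ?p" by (simp add: inner_prod_def)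
  qed
qed

lemma constrained_problem_dvg: "constrained_problem A_op dvg"
  by (intro constrained_problem.intro linear_A_op linear_dvg)

text \<open>Slater's condition holds because \<open>A_op\<close> maps
  \<open>P_set C\<^sub>s C\<^sub>t\<close> onto the whole space, already with
  \<open>y = 0\<close>.\<close>

lemma kkt_point_exists:
  fixes C\<^sub>s C\<^sub>t :: "('m::{finite,linorder}, 'n::{finite,linorder}) img"
  assumes "\<alpha> > 0"
  shows "\<exists>q p u. constrained_problem.kkt A_op dvg (1, 0) (P_set C\<^sub>s C\<^sub>t) (Q_set \<alpha>) q p u"
proof -
  obtain p q where pq: "p \<in> P_set C\<^sub>s C\<^sub>t" "q \<in> Q_set \<alpha>" "A_op p + dvg q = 0"
    "\<And>x y. x \<in> P_set C\<^sub>s C\<^sub>t \<Longrightarrow> y \<in> Q_set \<alpha> \<Longrightarrow> A_op x + dvg y = 0 \<Longrightarrow> (1, 0) \<bullet> x \<le> (1, 0) \<bullet> p"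
    using optimum_exists[OF assms] by blast
  have "w \<in> {A_op x + dvg y |x y. x \<in> P_set C\<^sub>s C\<^sub>t \<and> y \<in> Q_set \<alpha>}" for w
  proof -
    \<comment> \<open>\<open>a\<close> is the largest image with \<open>a\<close> below
      \<open>C\<^sub>s\<close> and \<open>a - w\<close> below \<open>C\<^sub>t\<close>.\<close>
    define a :: "('m, 'n) img" where "a = (\<chi> x. min (C\<^sub>s $ x) (C\<^sub>t $ x + w $ x))"
    have "w = A_op (a, a - w) + dvg 0" by (simp add: A_op_def linear_0[OF linear_dvg])
    moreover have "a $ x - w $ x \<le> C\<^sub>t $ x" for x by (simp add: a_def min_def)
    then have "(a, a - w) \<in> P_set C\<^sub>s C\<^sub>t" by (auto simp: P_set_def a_def)
    moreover have "0 \<in> Q_set \<alpha>" using assms by (simp add: Q_set_def)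
    ultimately show ?thesis by blast
  qed
  then have ball: "ball 0 1 \<subseteq> {A_op x + dvg y |x y. x \<in> P_set C\<^sub>s C\<^sub>t \<and> y \<in> Q_set \<alpha>}" by blast
  have "\<exists>u. constrained_problem.kkt A_op dvg (1, 0) (P_set C\<^sub>s C\<^sub>t) (Q_set \<alpha>) q p u"
    by (rule constrained_problem.kkt_exists[OF constrained_problem_dvg convex_P_set convex_Q_set
          pq(1-3) _ zero_less_one ball]) (rule pq(4))
  then show ?thesis by blast
qed

section \<open>Rigidity of the limit states at a single pixel\<close>

text \<open>\<open>s\<close>, \<open>t\<close>, \<open>v\<close> stand for both components of
  \<open>p\<close> and for \<open>u\<close> at one pixel in four consecutive limit states.
  Complementarity and the constant sum leave the pairs \<open>(-1, lo)\<close> and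
  \<open>(0, hi)\<close> for \<open>(v, d)\<close>, unless \<open>lo = hi\<close>.\<close>

lemma pixel_rigid:
  fixes s t v :: "nat \<Rightarrow> real"
  assumes c: "0 < c"
    and "\<And>i. i < 4 \<Longrightarrow> s i \<le> S \<and> t i \<le> T \<and> -1 \<le> v i \<and> v i \<le> 0 \<and> (v i = -1 \<or> s i = S) \<and> (v i = 0 \<or> t i = T)"
    and "\<And>i. i < 3 \<Longrightarrow> s (Suc i) + t (Suc i) = s i + t i"
    and "\<And>i. i < 3 \<Longrightarrow> v (Suc i) + c * (s (Suc i) - t (Suc i) + b) = v i - c * (s i - t i + b)"
  shows "s 1 - t 1 = s 2 - t 2"
proof -
  define d where "d i = c * (s i - t i + b)" for i
  define lo hi where "lo = c * (s 0 + t 0 - 2 * T + b)" and "hi = c * (2 * S - (s 0 + t 0) + b)"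
  have sum: "s i + t i = s 0 + t 0" if "i < 4" for i
    using that by (induction i) (use assms(3) in auto)
  have st: "v i = -1 \<and> d i = lo \<or> v i = 0 \<and> d i = hi \<or> d i = lo \<and> d i = hi" "-1 \<le> v i" "v i \<le> 0" if "i < 4" for i
  proof -
    have "d i = lo" if "t i = T" using sum[OF \<open>i < 4\<close>] that by (simp add: d_def lo_def)
    moreover have "d i = hi" if "s i = S" using sum[OF \<open>i < 4\<close>] that by (simp add: d_def hi_def)
    ultimately show "v i = -1 \<and> d i = lo \<or> v i = 0 \<and> d i = hi \<or> d i = lo \<and> d i = hi" "-1 \<le> v i" "v i \<le> 0"
      using assms(2)[OF that] by auto
  qed
  have "lo \<le> hi" unfolding lo_def hi_def
    using assms(2)[of 0] c by (intro mult_left_mono) auto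
  moreover have "v (Suc i) + d (Suc i) = v i - d i" if "i < 3" for i
    using assms(4)[OF that] by (simp add: d_def)
  from this[of 0] this[of 1] this[of 2]
  have "v 1 + d 1 = v 0 - d 0" "v 2 + d 2 = v 1 - d 1" "v 3 + d 3 = v 2 - d 2"
    by (simp_all add: eval_nat_numeral)
  \<comment> \<open>Let \<open>lo < hi\<close>. A jump from \<open>lo\<close> to \<open>hi\<close>
    between states 1 and 2 gives \<open>lo + hi = -1\<close>; state 3 then gives
    \<open>hi = 0\<close>, and state 0 would need \<open>v 0 - d 0 = -2\<close>, which neither pair
    satisfies. The downward jump is excluded in the same way.\<close>
  ultimately have "d 1 = d 2"
    using st(1)[of 0] st(1)[of 1] st(1)[of 2] st(1)[of 3] st(2-3)[of 0] st(2-3)[of 1] st(2-3)[of 2] st(2-3)[of 3]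
    by simp argo
  then show ?thesis using c by (simp add: d_def)
qed

text \<open>A single pixel is perturbed: lowering it by 1 is always admissible and yields the signs,
  raising it by its full slack yields complementarity.\<close>

lemma kkt_pixel:
  fixes p :: "('m::finite, 'n::finite) img \<times> ('m, 'n) img"
  assumes p: "p \<in> P_set C\<^sub>s C\<^sub>t" and vi: "\<And>x. x \<in> P_set C\<^sub>s C\<^sub>t \<Longrightarrow> (1, 0) \<bullet> (x - p) + u \<bullet> A_op (x - p) \<le> 0"
  shows "-1 \<le> u $ i" "u $ i \<le> 0" "u $ i = -1 \<or> fst p $ i = C\<^sub>s $ i" "u $ i = 0 \<or> snd p $ i = C\<^sub>t $ i"
proof -
  have le: "fst p $ j \<le> C\<^sub>s $ j" "snd p $ j \<le> C\<^sub>t $ j" for j using p unfolding P_set_def by blast+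
  have s: "(1 + u $ i) * d \<le> 0" if "d \<le> C\<^sub>s $ i - fst p $ i" for d
  proof -
    have "p + (axis i d, 0) \<in> P_set C\<^sub>s C\<^sub>t" using le that by (auto simp: P_set_def axis_def)
    from vi[OF this] show ?thesis
      by (simp add: A_op_def inner_prod_def inner_axis algebra_simps)
  qed
  have t: "- (u $ i) * d \<le> 0" if "d \<le> C\<^sub>t $ i - snd p $ i" for d
  proof -
    have "p + (0, axis i d) \<in> P_set C\<^sub>s C\<^sub>t" using le that by (auto simp: P_set_def axis_def)
    from vi[OF this] show ?thesis
      by (simp add: A_op_def inner_prod_def inner_axis algebra_simps)
  qed
  show u1: "-1 \<le> u $ i" using s[of "-1"] le(1)[of i] by simp
  show u0: "u $ i \<le> 0" using t[of "-1"] le(2)[of i] by simp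
  show "u $ i = -1 \<or> fst p $ i = C\<^sub>s $ i"
    using s[OF order_refl] u1 le(1)[of i] by (auto simp: mult_le_0_iff)
  show "u $ i = 0 \<or> snd p $ i = C\<^sub>t $ i"
    using t[OF order_refl] u0 le(2)[of i] by (auto simp: mult_le_0_iff zero_le_mult_iff)
qed

section \<open>Specialization of the abstract convergence results to \<open>A_op\<close> and
  \<open>dvg\<close>\<close>

theorem theorem1:
  fixes \<alpha> :: real
    and C\<^sub>s C\<^sub>t :: "('m :: {finite, linorder}, 'n :: {finite, linorder}) img"
  assumes "\<alpha> > 0"
  defines "A \<equiv> (A_op :: ('m, 'n) img \<times> ('m, 'n) img \<Rightarrow> ('m, 'n) img)"
    and "B \<equiv> (dvg :: ('m, 'n) vfield \<Rightarrow> ('m, 'n) img)"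
    and "G \<equiv> G_fun C\<^sub>s C\<^sub>t"
    and "H \<equiv> (H_fun \<alpha> :: ('m, 'n) vfield \<Rightarrow> ereal)"
  shows "op_ge (\<lambda>q. 8 *\<^sub>R q) (\<lambda>q. adjoint B (B q)) \<and>
    op_ge (\<lambda>p. 2 *\<^sub>R p) (\<lambda>p. adjoint A (A p)) \<and>
    (\<forall>c > 0. let N = (\<lambda>q. (8 * c) *\<^sub>R q); M = (\<lambda>p. (2 * c) *\<^sub>R p) in
       op_ge (\<lambda>q. N q - c *\<^sub>R adjoint B (B q)) (\<lambda>q. 0) \<and>
       op_ge (\<lambda>p. M p - c *\<^sub>R adjoint A (A p)) (\<lambda>p. 0) \<and>
       (\<forall>\<rho> :: nat \<Rightarrow> real. mono \<rho> \<and> (\<forall>k. \<rho> k \<in> {0<..<2}) \<longrightarrow>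
          (\<forall>q\<^sub>0 p\<^sub>0 u\<^sub>0 q p u. q 0 = q\<^sub>0 \<and> p 0 = p\<^sub>0 \<and> u 0 = u\<^sub>0 \<and>
             generates_iterates A B G H c N M \<rho> q p u \<longrightarrow>
             (\<exists>qs ps us. weakly_converges (\<lambda>k. (q k, p k, u k)) (qs, ps, us) \<and>
                saddle_point (aug_lagrangian A B G H c) (qs, ps, us) \<and>
                solves_constrained_max A B G H (qs, ps)))))"
proof -
  have 1: "op_ge (\<lambda>q. 8 *\<^sub>R q) (\<lambda>q. adjoint B (B q))" "op_ge (\<lambda>p. 2 *\<^sub>R p) (\<lambda>p. adjoint A (A p))"
    unfolding A_def B_def
    using op_ge_adjoint(1)[OF linear_dvg dvg_bound(1) order_refl] op_ge_adjoint(1)[OF linear_A_op A_op_bound order_refl]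
    by blast+
  have 2: "op_ge (\<lambda>q. (8 * c) *\<^sub>R q - c *\<^sub>R adjoint B (B q)) (\<lambda>q. 0)"
    "op_ge (\<lambda>p. (2 * c) *\<^sub>R p - c *\<^sub>R adjoint A (A p)) (\<lambda>p. 0)" if "c > 0" for c
    unfolding A_def B_def
    using op_ge_adjoint(2)[OF linear_dvg dvg_bound(1), of c] op_ge_adjoint(2)[OF linear_A_op A_op_bound, of c] that
    by simp_all
  have 3: "\<exists>qs ps us. weakly_converges (\<lambda>k. (q k, p k, u k)) (qs, ps, us) \<and>
                saddle_point (aug_lagrangian A B G H c) (qs, ps, us) \<and>
                solves_constrained_max A B G H (qs, ps)"
    if c: "c > 0" and rho: "mono \<rho>" "\<forall>k. \<rho> k \<in> {0<..<2}"
      and gen: "generates_iterates A B G H c (\<lambda>q. (8 * c) *\<^sub>R q) (\<lambda>p. (2 * c) *\<^sub>R p) \<rho> q p u"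
    for c \<rho> q p u
  proof -
    interpret relaxed_admm A B "(1, 0)" "P_set C\<^sub>s C\<^sub>t" "Q_set \<alpha>" c "2 * c" "8 * c" \<rho> q p u
    proof (rule relaxed_admm_of_generates_iterates)
      show "generates_iterates A B (\<lambda>x. ereal (- ((1, 0) \<bullet> x)) + ind_fun (P_set C\<^sub>s C\<^sub>t) x) (ind_fun (Q_set \<alpha>)) c
        (\<lambda>q. (8 * c) *\<^sub>R q) (\<lambda>p. (2 * c) *\<^sub>R p) \<rho> q p u"
        using gen unfolding G_def H_def G_fun_eq H_fun_eq .
      show "c * (A x \<bullet> A x) \<le> 2 * c * (x \<bullet> x)" for x
        using mult_left_mono[OF A_op_bound[of x], of c] c by (simp add: A_def algebra_simps)
      show "c * (B x \<bullet> B x) \<le> 8 * c * (x \<bullet> x)" for x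
        using mult_left_mono[OF dvg_bound(1)[of x], of c] c by (simp add: B_def algebra_simps)
      have "(C\<^sub>s, C\<^sub>t) \<in> P_set C\<^sub>s C\<^sub>t" by (simp add: P_set_def)
      then show "P_set C\<^sub>s C\<^sub>t \<noteq> {}" by blast
      have "0 \<in> (Q_set \<alpha> :: ('m, 'n) vfield set)" using assms(1) by (simp add: Q_set_def)
      then show "(Q_set \<alpha> :: ('m, 'n) vfield set) \<noteq> {}" by blast
    qed (use c rho in \<open>auto simp: A_def B_def linear_A_op linear_dvg closed_P_set convex_P_set
          closed_Q_set convex_Q_set bounded_Q_set\<close>)
    obtain q0 p0 u0 where kkt0: "kkt q0 p0 u0"
      using kkt_point_exists[OF assms(1), of C\<^sub>s C\<^sub>t] unfolding A_def B_def by blast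
    obtain r where r: "\<rho> \<longlonglongrightarrow> r" "r \<le> 2" by (rule rho_limit)
    have "res \<longlonglongrightarrow> 0"
    proof (cases "r < 2")
      case True
      then show ?thesis by (rule res_tendsto_0_underrelaxed[OF kkt0 r(1)])
    next
      case False
      with r have "\<rho> \<longlonglongrightarrow> 2" by simp
      then show ?thesis
      proof (rule res_tendsto_0_limit_2[OF kkt0])
        fix x assume "qform x x = 0"
        \<comment> \<open>A null vector of the \<open>q\<close>-seminorm is an equality case of
          \<open>dvg_bound\<close>.\<close>
        then have "c * (B x \<bullet> B x) = c * (8 * (x \<bullet> x))" unfolding qform_def by linarith
        then have "B x \<bullet> B x = 8 * (x \<bullet> x)" using c by simp
        then show "x = 0" unfolding B_def by (rule dvg_bound(2))
      next
        fix pp :: "nat \<Rightarrow> ('m, 'n) img \<times> ('m, 'n) img" and uu :: "nat \<Rightarrow> ('m, 'n) img" and b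
        assume vi: "\<And>i. i < 4 \<Longrightarrow> pp i \<in> P_set C\<^sub>s C\<^sub>t \<and>
            (\<forall>x\<in>P_set C\<^sub>s C\<^sub>t. (1, 0) \<bullet> (x - pp i) + uu i \<bullet> A (x - pp i) \<le> 0)"
          and pz: "\<And>i. i < 3 \<Longrightarrow> pform (pp (Suc i) - pp i) (pp (Suc i) - pp i) = 0"
          and step: "\<And>i. i < 3 \<Longrightarrow> uu (Suc i) + c *\<^sub>R (A (pp (Suc i)) + b) = uu i - c *\<^sub>R (A (pp i) + b)"
        show "A (pp 1) = A (pp 2)"
          unfolding vec_eq_iff
        proof
          fix x
          \<comment> \<open>Bounds, stationarity and reflection all decouple over the
            pixels.\<close>
          have "fst (pp 1) $ x - snd (pp 1) $ x = fst (pp 2) $ x - snd (pp 2) $ x"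
          proof (rule pixel_rigid[OF c, where v = "\<lambda>i. uu i $ x" and b = "b $ x"
                and S = "C\<^sub>s $ x" and T = "C\<^sub>t $ x"])
            fix i :: nat assume "i < 4"
            then have P: "pp i \<in> P_set C\<^sub>s C\<^sub>t" and
              V: "\<And>x. x \<in> P_set C\<^sub>s C\<^sub>t \<Longrightarrow> (1, 0) \<bullet> (x - pp i) + uu i \<bullet> A_op (x - pp i) \<le> 0"
              using vi[of i] by (auto simp: A_def)
            show "fst (pp i) $ x \<le> C\<^sub>s $ x \<and> snd (pp i) $ x \<le> C\<^sub>t $ x \<and> -1 \<le> uu i $ x \<and> uu i $ x \<le> 0 \<and>
              (uu i $ x = -1 \<or> fst (pp i) $ x = C\<^sub>s $ x) \<and> (uu i $ x = 0 \<or> snd (pp i) $ x = C\<^sub>t $ x)"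
              using kkt_pixel[OF P V, of x] P[unfolded P_set_def] by blast
          next
            fix i :: nat assume i: "i < 3"
            let ?d = "pp (Suc i) - pp i"
            \<comment> \<open>By the parallelogram identity \<open>pform ?d ?d\<close> is
              \<open>c\<close> times the squared norm of \<open>fst ?d + snd ?d\<close>.\<close>
            have "c * (2 * (?d \<bullet> ?d) - A_op ?d \<bullet> A_op ?d) = 0"
              using pz[OF i] unfolding pform_def unfolding A_def right_diff_distrib by linarith
            then have "fst ?d + snd ?d = 0" using c unfolding A_op_parallelogram by simp
            then have "(fst ?d + snd ?d) $ x = 0" by simp
            then show "fst (pp (Suc i)) $ x + snd (pp (Suc i)) $ x = fst (pp i) $ x + snd (pp i) $ x"
              by (simp add: algebra_simps)
            have "(uu (Suc i) + c *\<^sub>R (A (pp (Suc i)) + b)) $ x = (uu i - c *\<^sub>R (A (pp i) + b)) $ x"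
              using step[OF i] by simp
            then show "uu (Suc i) $ x + c * (fst (pp (Suc i)) $ x - snd (pp (Suc i)) $ x + b $ x)
                = uu i $ x - c * (fst (pp i) $ x - snd (pp i) $ x + b $ x)"
              by (simp add: A_def A_op_def)
          qed
          then show "A (pp 1) $ x = A (pp 2) $ x" by (simp add: A_def A_op_def)
        qed
      qed
    qed
    from convergence[OF kkt0 this] obtain qs ps us where kkt: "kkt qs ps us"
      and lim: "q \<longlonglongrightarrow> qs" "p \<longlonglongrightarrow> ps" "u \<longlonglongrightarrow> us" by blast
    have weak: "weakly_converges (\<lambda>k. (q k, p k, u k)) (qs, ps, us)"
      unfolding weakly_converges_def
      using bounded_linear.tendsto[OF _ tendsto_Pair[OF lim(1) tendsto_Pair[OF lim(2,3)]]] by blast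
    have "0 \<le> c" using c by simp
    then show ?thesis
      unfolding G_def H_def G_fun_eq H_fun_eq
      using weak kkt_saddle_point[OF kkt] kkt_solves[OF kkt] by blast
  qed
  show ?thesis unfolding Let_def using 1 2 3 by blast
qed

end
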